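(* The Acyclic Matching problem restricted to bipartite input graphs is W[1]-hard with respect to the parameter $k$.
   Context: All graphs are finite, simple, undirected and loopless. A matching $M$ in a graph $G$ is a set of pairwise nonadjacent edges; $G[M]$ is the subgraph of $G$ induced on the set of endpoints of the edges of $M$. A matching $M$ is acyclic if $G[M]$ is acyclic. The Acyclic Matching problem: given a graph $G$ and a positive integer $k$, decide whether $G$ has an acyclic matching $M$ with $|M|=k$; the parameter is $k$. *)

theory Defs
  imports Main
begin

section \<open>A model of computation\<close>

text \<open>Imperative programs over binary trees (the WHILE language of Jones). An assignment is charged
  the size of the value it stores, so the total size of the variables of a program never exceeds the
  size of the input plus the time used plus the number of these variables. Such programs and Turing machines simulate each other with
  polynomial overhead, also as far as the computation of functions is concerned. (With unit cost for
  assignments, a value of size exponential in the running time could be output.)\<close>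

datatype data = Leaf | Node data data

fun data_size :: "data \<Rightarrow> nat" where
  "data_size Leaf = 1"
| "data_size (Node a b) = 1 + data_size a + data_size b"

fun data_hd :: "data \<Rightarrow> data" where
  "data_hd Leaf = Leaf"
| "data_hd (Node a b) = a"

fun data_tl :: "data \<Rightarrow> data" where
  "data_tl Leaf = Leaf"
| "data_tl (Node a b) = b"

type_synonym store = "nat \<Rightarrow> data"

datatype expr = Var nat | Nl | Cns expr expr | Hd expr | Tl expr

fun eval :: "expr \<Rightarrow> store \<Rightarrow> data" where
  "eval (Var x) s = s x"
| "eval Nl s = Leaf"
| "eval (Cns a b) s = Node (eval a s) (eval b s)"
| "eval (Hd a) s = data_hd (eval a s)"
| "eval (Tl a) s = data_tl (eval a s)"

datatype com =
    Skip
  | Assign nat expr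
  | Seq com com
  | Cond expr com com
  | While expr com

text \<open>\<open>exec c s t s'\<close>: started in the store \<open>s\<close>, the program \<open>c\<close> halts after time \<open>t\<close> in the
  store \<open>s'\<close>. A test fails exactly on \<^const>\<open>Leaf\<close>.\<close>

inductive exec :: "com \<Rightarrow> store \<Rightarrow> nat \<Rightarrow> store \<Rightarrow> bool" where
  Skip: "exec Skip s 1 s"
| Assign: "exec (Assign x e) s (1 + data_size (eval e s)) (s(x := eval e s))"
| Seq: "exec c1 s t1 s1 \<Longrightarrow> exec c2 s1 t2 s2 \<Longrightarrow> exec (Seq c1 c2) s (t1 + t2) s2"
| CondTrue: "eval e s \<noteq> Leaf \<Longrightarrow> exec c1 s t s1 \<Longrightarrow> exec (Cond e c1 c2) s (1 + t) s1"
| CondFalse: "eval e s = Leaf \<Longrightarrow> exec c2 s t s1 \<Longrightarrow> exec (Cond e c1 c2) s (1 + t) s1"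
| WhileFalse: "eval e s = Leaf \<Longrightarrow> exec (While e c) s 1 s"
| WhileTrue: "eval e s \<noteq> Leaf \<Longrightarrow> exec c s t1 s1 \<Longrightarrow> exec (While e c) s1 t2 s2 \<Longrightarrow>
    exec (While e c) s (1 + t1 + t2) s2"

lemma exec_deterministic:
  "exec c s t s1 \<Longrightarrow> exec c s t' s1' \<Longrightarrow> t' = t \<and> s1' = s1"
proof (induction arbitrary: t' s1' rule: exec.induct)
  case (Seq c1 s t1 s1 c2 t2 s2)
  from Seq.prems show ?case by cases (use Seq.IH in blast)
next
  case (WhileTrue e s c t1 s1 t2 s2)
  from WhileTrue.prems show ?case by cases (use WhileTrue.IH WhileTrue.hyps in blast)+
qed (erule exec.cases; force)+

text \<open>Input and output are passed in variable 0; all other variables are initially \<^const>\<open>Leaf\<close>.\<close>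

definition computes_in :: "com \<Rightarrow> data \<Rightarrow> nat \<Rightarrow> data \<Rightarrow> bool" where
  "computes_in c inp t out \<longleftrightarrow> (\<exists>s. exec c ((\<lambda>_. Leaf)(0 := inp)) t s \<and> s 0 = out)"

fun data_of_list :: "('a \<Rightarrow> data) \<Rightarrow> 'a list \<Rightarrow> data" where
  "data_of_list f [] = Leaf"
| "data_of_list f (x # xs) = Node (f x) (data_of_list f xs)"

definition data_of_bool :: "bool \<Rightarrow> data" where
  "data_of_bool b = (if b then Node Leaf Leaf else Leaf)"

definition data_of_nat :: "nat \<Rightarrow> data" where
  "data_of_nat n = data_of_list (\<lambda>_. Leaf) (replicate n ())"

definition computable :: "(nat \<Rightarrow> nat) \<Rightarrow> bool" where
  "computable f \<longleftrightarrow> (\<exists>c. \<forall>k. \<exists>t. computes_in c (data_of_nat k) t (data_of_nat (f k)))"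


section \<open>Parameterized problems and fpt-reductions\<close>

text \<open>A parameterized problem is a set of pairs of a string and a parameter; strings that do not
  encode an instance are no-instances.\<close>

type_synonym param_problem = "(bool list \<times> nat) set"

definition data_of_instance :: "bool list \<Rightarrow> nat \<Rightarrow> data" where
  "data_of_instance x k = Node (data_of_list data_of_bool x) (data_of_nat k)"

definition fpt_reducible :: "param_problem \<Rightarrow> param_problem \<Rightarrow> bool" where
  "fpt_reducible A B \<longleftrightarrow>
    (\<exists>c f g e. computable f \<and> computable g \<and>
      (\<forall>x k. \<exists>x' k' t.
        computes_in c (data_of_instance x k) t (data_of_instance x' k') \<and>
        t \<le> f k * (length x + 1) ^ e \<and>
        k' \<le> g k \<and>
        ((x, k) \<in> A \<longleftrightarrow> (x', k') \<in> B)))"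


section \<open>The class W[1]\<close>

text \<open>W[1] is the closure under fpt-reductions of the problems, one for each \<open>d \<ge> 1\<close>, of deciding
  whether a given formula in \<open>d\<close>-CNF has a satisfying assignment of weight exactly \<open>k\<close>, with
  parameter \<open>k\<close>; in the notation of Flum and Grohe, these are the problems p-WSAT(\<open>\<Gamma>\<^sub>1\<^sub>,\<^sub>d\<close>).
  A literal is a pair of a sign (\<^const>\<open>True\<close> for positive) and a variable. An assignment is given
  by the set of variables of the formula that it makes true.\<close>

type_synonym literal = "bool \<times> nat"
type_synonym clause = "literal list"
type_synonym cnf = "clause list"

definition cnf_vars :: "cnf \<Rightarrow> nat set" where
  "cnf_vars \<phi> = (\<Union>C\<in>set \<phi>. snd ` set C)"

definition satisfies :: "nat set \<Rightarrow> cnf \<Rightarrow> bool" where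
  "satisfies S \<phi> \<longleftrightarrow> (\<forall>C\<in>set \<phi>. \<exists>(b, v)\<in>set C. (v \<in> S) = b)"

definition is_d_cnf :: "nat \<Rightarrow> cnf \<Rightarrow> bool" where
  "is_d_cnf d \<phi> \<longleftrightarrow> (\<forall>C\<in>set \<phi>. length C \<le> d)"

definition encode_nat :: "nat \<Rightarrow> bool list" where
  "encode_nat n = replicate n True @ [False]"

definition encode_list :: "('a \<Rightarrow> bool list) \<Rightarrow> 'a list \<Rightarrow> bool list" where
  "encode_list f xs = concat (map (\<lambda>x. True # f x) xs) @ [False]"

definition encode_literal :: "literal \<Rightarrow> bool list" where
  "encode_literal l = fst l # encode_nat (snd l)"

definition encode_cnf :: "cnf \<Rightarrow> bool list" where
  "encode_cnf = encode_list (encode_list encode_literal)"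

lemma encode_nat_prefix_free:
  "encode_nat m @ r = encode_nat n @ r' \<Longrightarrow> m = n \<and> r = r'"
proof (induction m arbitrary: n)
  case 0
  then show ?case by (cases n) (auto simp: encode_nat_def)
next
  case (Suc m)
  then show ?case by (cases n) (auto simp: encode_nat_def)
qed

lemma encode_list_prefix_free:
  assumes "\<And>x y r r'. f x @ r = f y @ r' \<Longrightarrow> x = y \<and> r = r'"
  shows "encode_list f xs @ r = encode_list f ys @ r' \<Longrightarrow> xs = ys \<and> r = r'"
proof (induction xs arbitrary: ys)
  case Nil
  then show ?case by (cases ys) (auto simp: encode_list_def)
next
  case (Cons x xs)
  then show ?case
    by (cases ys) (auto simp: encode_list_def dest!: assms)
qed

lemma encode_literal_prefix_free:
  "encode_literal l @ r = encode_literal l' @ r' \<Longrightarrow> l = l' \<and> r = r'"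
  by (auto simp: encode_literal_def prod_eq_iff dest!: encode_nat_prefix_free)

lemma inj_encode_cnf: "inj encode_cnf"
proof (rule injI)
  fix \<phi> \<psi> assume "encode_cnf \<phi> = encode_cnf \<psi>"
  then have "encode_cnf \<phi> @ [] = encode_cnf \<psi> @ []" by simp
  then show "\<phi> = \<psi>"
    unfolding encode_cnf_def
    by (metis encode_list_prefix_free encode_literal_prefix_free)
qed

definition weighted_cnf_sat :: "nat \<Rightarrow> param_problem" where
  "weighted_cnf_sat d =
    {(encode_cnf \<phi>, k) | \<phi> k. is_d_cnf d \<phi> \<and>
      (\<exists>S. S \<subseteq> cnf_vars \<phi> \<and> card S = k \<and> satisfies S \<phi>)}"

definition W1 :: "param_problem set" where
  "W1 = {A. \<exists>d\<ge>1. fpt_reducible A (weighted_cnf_sat d)}"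

definition W1_hard :: "param_problem \<Rightarrow> bool" where
  "W1_hard B \<longleftrightarrow> (\<forall>A\<in>W1. fpt_reducible A B)"


section \<open>Acyclic matchings\<close>

text \<open>A graph is a pair of a vertex set and a set of edges.\<close>

type_synonym 'a graph = "'a set \<times> 'a set set"

definition simple_graph :: "'a graph \<Rightarrow> bool" where
  "simple_graph G \<longleftrightarrow> finite (fst G) \<and> (\<forall>e\<in>snd G. e \<subseteq> fst G \<and> card e = 2)"

definition induced_subgraph :: "'a graph \<Rightarrow> 'a set \<Rightarrow> 'a graph" where
  "induced_subgraph G U = (fst G \<inter> U, {e \<in> snd G. e \<subseteq> U})"

definition cycle_in :: "'a graph \<Rightarrow> 'a list \<Rightarrow> bool" where
  "cycle_in G vs \<longleftrightarrow> length vs \<ge> 3 \<and> distinct vs \<and>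
    (\<forall>i<length vs. {vs ! i, vs ! (Suc i mod length vs)} \<in> snd G)"

definition acyclic_graph :: "'a graph \<Rightarrow> bool" where
  "acyclic_graph G \<longleftrightarrow> (\<nexists>vs. cycle_in G vs)"

definition bipartite :: "'a graph \<Rightarrow> bool" where
  "bipartite G \<longleftrightarrow>
    (\<exists>X Y. X \<union> Y = fst G \<and> X \<inter> Y = {} \<and> (\<forall>e\<in>snd G. \<exists>x\<in>X. \<exists>y\<in>Y. e = {x, y}))"

definition matching :: "'a graph \<Rightarrow> 'a set set \<Rightarrow> bool" where
  "matching G M \<longleftrightarrow> M \<subseteq> snd G \<and> (\<forall>e\<in>M. \<forall>e'\<in>M. e \<noteq> e' \<longrightarrow> e \<inter> e' = {})"

definition acyclic_matching :: "'a graph \<Rightarrow> 'a set set \<Rightarrow> bool" where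
  "acyclic_matching G M \<longleftrightarrow> matching G M \<and> acyclic_graph (induced_subgraph G (\<Union>M))"

text \<open>Input graphs have vertex set \<open>{..<n}\<close> and are given by \<open>n\<close> in unary, followed by the rows of the
  adjacency matrix.\<close>

definition encode_graph :: "nat graph \<Rightarrow> bool list" where
  "encode_graph G = (let n = card (fst G) in
    encode_nat n @ concat (map (\<lambda>i. map (\<lambda>j. {i, j} \<in> snd G) [0..<n]) [0..<n]))"

lemma encode_graph_inj:
  assumes "fst G = {..<n}" "simple_graph G" "fst H = {..<m}" "simple_graph H"
    and "encode_graph G = encode_graph H"
  shows "G = H"
proof -
  let ?row = "\<lambda>G i. map (\<lambda>j. {i, j} \<in> snd G) [0..<n]"
  have enc: "m = n \<and> concat (map (?row G) [0..<n]) = concat (map (?row H) [0..<n])"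
    using assms(5) unfolding encode_graph_def assms(1,3) Let_def card_lessThan
    by (metis encode_nat_prefix_free)
  have "map (?row G) [0..<n] = map (?row H) [0..<n]"
  proof (rule concat_injective)
    show "\<forall>(x, y)\<in>set (zip (map (?row G) [0..<n]) (map (?row H) [0..<n])). length x = length y"
      by (auto simp: set_zip)
  qed (use enc in auto)
  then have adj: "{i, j} \<in> snd G \<longleftrightarrow> {i, j} \<in> snd H" if "i < n" "j < n" for i j
    using that by (auto simp: map_eq_conv)
  have edge: "\<exists>i j. e = {i, j} \<and> i < n \<and> j < n" if "e \<in> snd G \<or> e \<in> snd H" for e
  proof -
    have "e \<subseteq> {..<n}" "card e = 2"
      using that assms enc unfolding simple_graph_def by auto
    then show ?thesis by (auto simp: card_2_iff)
  qed
  have "snd G = snd H" using adj edge by blast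
  then show ?thesis using assms(1,3) enc by (simp add: prod_eq_iff)
qed

definition acyclic_matching_problem :: "(nat graph \<Rightarrow> bool) \<Rightarrow> param_problem" where
  "acyclic_matching_problem P =
    {(encode_graph G, k) | G k. (\<exists>n. fst G = {..<n}) \<and> simple_graph G \<and> P G \<and> k > 0 \<and>
      (\<exists>M. acyclic_matching G M \<and> card M = k)}"

end

theory Submission
  imports Defs
begin

text \<open>Weighted satisfiability of \<open>d\<close>-CNF formulas is reduced directly to acyclic matching.

  A set of variables of size \<open>k\<close> is an increasing sequence \<open>s 0 < s 1 < \<dots> < s (k + 1)\<close> with
  sentinels at both ends. A literal is falsified because of two consecutive values of \<open>s\<close>, so a
  falsified clause is witnessed by at most \<open>2 d\<close> values. Take as elements all lists of \<open>2 d\<close> pairs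
  \<open>(p, v)\<close>, read as \<open>s p = v\<close>, that witness no violation; two elements conflict if they assign different
  values to the same \<open>p\<close>. Satisfying sets of size \<open>k\<close> correspond to conflict-free sets of
  \<open>(k + 2)^(2 d)\<close> elements, one for each list of positions.

  In the bipartite graph every element \<open>e\<close> has \<open>t\<close> copies, each consisting of an edge \<open>a b\<close>, and the
  \<open>a\<close>-vertices of \<open>e\<close> are joined to the \<open>b\<close>-vertices of \<open>e'\<close> whenever \<open>e\<close> and \<open>e'\<close> conflict. Copies of two
  conflicting elements span a 4-cycle. The conflicts at one position \<open>p\<close> form two half graphs (\<open>v < v'\<close>
  and \<open>v > v'\<close>), and an acyclic matching contains at most two edges of a half graph. So with
  \<open>t > 4 (k + 2)\<close> an acyclic matching of size \<open>(k + 2)^(2 d) t\<close> must use copies of \<open>(k + 2)^(2 d)\<close>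
  pairwise conflict-free elements.\<close>

section \<open>Polynomial-time functions on trees\<close>

text \<open>That a variable is false is not witnessed by any single chosen value. Once the chosen
  variables are sorted, the two consecutive values around it prove it, and the sentinels provide
  such neighbours at both ends. So a literal costs two pins and a clause at most
  \<open>2 * d\<close>; for fixed \<open>d\<close> this keeps the list of elements polynomial and
  the target size a function of \<open>k\<close> alone. Elements that witness a violation are left
  out, so clauses only remove vertices, and the graph has to express nothing but conflicts. The
  obstacle in the bipartite graph is that a matching may use edges between copies of different
  conflicting elements; such edges select nothing. Conflict compares numbers at one of
  \<open>k + 2\<close> positions, hence it is a union of \<open>2 * (k + 2)\<close> half graphs,
  whatever the number of variables. The resulting loss of at most \<open>4 * (k + 2)\<close> edges
  is less than \<open>t\<close>, so it cannot make up for a single missing element.\<close>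

lemma data_size_pos [simp]: "0 < data_size d"
  by (cases d) auto

lemma data_size_hd_le: "data_size (data_hd d) \<le> data_size d"
  by (cases d) auto

lemma data_size_tl_le: "data_size (data_tl d) \<le> data_size d"
  by (cases d) auto

lemma data_size_hd_tl: "data_size (data_hd d) + data_size (data_tl d) \<le> data_size d + 1"
  by (cases d) auto

text \<open>Each assignment is charged the size of the value it stores, so time pays for growth.
  Time bounds thus become size bounds, both for outputs and for the instance handed on in a
  composition.\<close>

lemma exec_data_size: "exec c s t s' \<Longrightarrow> data_size (s' y) \<le> data_size (s y) + t"
  by (induction rule: exec.induct) auto

section \<open>Arithmetic of polynomial bounds\<close>

lemma power_add_power_le:
  fixes n :: nat assumes "2 \<le> n" shows "n ^ a + n ^ b \<le> n ^ (a + b + 1)"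
proof -
  have "n ^ a \<le> n ^ (a + b)" "n ^ b \<le> n ^ (a + b)" using assms by (auto intro: power_increasing)
  then have "n ^ a + n ^ b \<le> 2 * n ^ (a + b)" by simp
  also have "\<dots> \<le> n * n ^ (a + b)" using assms by (intro mult_right_mono) auto
  finally show ?thesis by simp
qed

text \<open>The base is at least 2, so a single exponent absorbs constants, sums and products, and
  no coefficients have to be tracked.\<close>

definition poly_bounded :: "('a \<Rightarrow> nat) \<Rightarrow> ('a \<Rightarrow> nat) \<Rightarrow> bool" where
  "poly_bounded n f \<longleftrightarrow> (\<exists>e. \<forall>x. f x \<le> (n x + 2) ^ e)"

lemma poly_boundedI: "(\<And>x. f x \<le> (n x + 2) ^ e) \<Longrightarrow> poly_bounded n f"
  unfolding poly_bounded_def by blast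

lemma poly_bounded_mono:
  assumes "poly_bounded n g" "\<And>x. f x \<le> g x" shows "poly_bounded n f"
  using assms unfolding poly_bounded_def by (meson order_trans)

lemma poly_bounded_self: "poly_bounded n n"
  by (rule poly_boundedI[where e = 1]) simp

lemma poly_bounded_const: "poly_bounded n (\<lambda>_. c)"
proof (rule poly_boundedI)
  fix x
  have "c \<le> 2 ^ c" using less_exp less_imp_le by blast
  also have "\<dots> \<le> (n x + 2) ^ c" by (rule power_mono) auto
  finally show "c \<le> (n x + 2) ^ c" .
qed

lemma poly_bounded_add:
  assumes "poly_bounded n f" "poly_bounded n g" shows "poly_bounded n (\<lambda>x. f x + g x)"
proof -
  obtain a b where "\<And>x. f x \<le> (n x + 2) ^ a" "\<And>x. g x \<le> (n x + 2) ^ b"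
    using assms unfolding poly_bounded_def by blast
  then have "f x + g x \<le> (n x + 2) ^ (a + b + 1)" for x
    using power_add_power_le[of "n x + 2" a b] by (meson add_mono le_add2 order_trans)
  then show ?thesis by (rule poly_boundedI)
qed

lemma poly_bounded_mult:
  assumes "poly_bounded n f" "poly_bounded n g" shows "poly_bounded n (\<lambda>x. f x * g x)"
proof -
  obtain a b where "\<And>x. f x \<le> (n x + 2) ^ a" "\<And>x. g x \<le> (n x + 2) ^ b"
    using assms unfolding poly_bounded_def by blast
  then have "f x * g x \<le> (n x + 2) ^ (a + b)" for x
    by (simp add: mult_mono power_add)
  then show ?thesis by (rule poly_boundedI)
qed

lemma poly_bounded_power:
  assumes "poly_bounded n f" shows "poly_bounded n (\<lambda>x. f x ^ e)"
proof -
  obtain a where "\<And>x. f x \<le> (n x + 2) ^ a"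
    using assms unfolding poly_bounded_def by blast
  then have "f x ^ e \<le> (n x + 2) ^ (a * e)" for x
    by (simp add: power_mono power_mult)
  then show ?thesis by (rule poly_boundedI)
qed

lemma poly_bounded_compose:
  assumes "poly_bounded m f" "poly_bounded n (\<lambda>x. m (h x))"
  shows "poly_bounded n (\<lambda>x. f (h x))"
proof -
  obtain a where a: "\<And>x. f x \<le> (m x + 2) ^ a"
    using assms(1) unfolding poly_bounded_def by blast
  have "poly_bounded n (\<lambda>x. (m (h x) + 2) ^ a)"
    by (intro poly_bounded_power poly_bounded_add poly_bounded_const assms(2))
  then show ?thesis by (rule poly_bounded_mono) (rule a)
qed

lemmas poly_bounded_intros =
  poly_bounded_self poly_bounded_const poly_bounded_add poly_bounded_mult poly_bounded_power

text \<open>The program must work from every store, so it may not rely on scratch variables being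
  \<open>Leaf\<close>, and it promises nothing about them afterwards. This is what allows such
  programs to be run one after the other.\<close>

definition ptime_store :: "(data \<Rightarrow> data) \<Rightarrow> bool" where
  "ptime_store F \<longleftrightarrow> (\<exists>c T. poly_bounded data_size T \<and>
    (\<forall>s. \<exists>t s'. exec c s t s' \<and> s' 0 = F (s 0) \<and> t \<le> T (s 0)))"

lemma ptime_storeI:
  assumes "\<And>s. \<exists>t s'. exec c s t s' \<and> s' 0 = F (s 0) \<and> t \<le> T (s 0)"
    and "poly_bounded data_size T"
  shows "ptime_store F"
  using assms unfolding ptime_store_def by blast

lemma ptime_storeE:
  assumes "ptime_store F"
  obtains c T where "poly_bounded data_size T"
    "\<And>s. \<exists>t s'. exec c s t s' \<and> s' 0 = F (s 0) \<and> t \<le> T (s 0)"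
  using assms unfolding ptime_store_def by blast

lemma ptime_store_size:
  assumes "ptime_store F" shows "poly_bounded data_size (\<lambda>x. data_size (F x))"
proof -
  obtain c T where T: "poly_bounded data_size T"
    and c: "\<And>s. \<exists>t s'. exec c s t s' \<and> s' 0 = F (s 0) \<and> t \<le> T (s 0)"
    using ptime_storeE[OF assms] by metis
  have "data_size (F x) \<le> data_size x + T x" for x
  proof -
    obtain t s' where "exec c (\<lambda>_. x) t s'" "s' 0 = F x" "t \<le> T x"
      using c[of "\<lambda>_. x"] by auto
    then show ?thesis using exec_data_size[of c "\<lambda>_. x" t s' 0] by auto
  qed
  then show ?thesis
    by (rule poly_bounded_mono[rotated]) (intro poly_bounded_intros T)
qed

lemma ptime_store_expr:
  assumes "\<And>s. eval b s = F (s 0)" shows "ptime_store F"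
proof -
  \<comment> \<open>Measuring on constant stores gives every variable the size of \<open>x\<close>,
    so the induction need not know which variables \<open>b\<close> mentions.\<close>
  have size: "poly_bounded data_size (\<lambda>x. data_size (eval b (\<lambda>_. x)))"
  proof (induction b)
    case (Hd b)
    show ?case by (rule poly_bounded_mono[OF Hd]) (simp add: data_size_hd_le)
  next
    case (Tl b)
    show ?case by (rule poly_bounded_mono[OF Tl]) (simp add: data_size_tl_le)
  qed (auto intro!: poly_bounded_intros poly_bounded_const[of _ 1, simplified]
        poly_bounded_add[of _ "\<lambda>_. Suc 0", simplified] poly_bounded_const[of _ "Suc 0"])
  have "exec (Assign 0 b) s (1 + data_size (F (s 0))) (s(0 := F (s 0)))" for s
    using exec.Assign[of 0 b s] assms by simp
  moreover have "poly_bounded data_size (\<lambda>x. 1 + data_size (F x))"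
    using size assms by (auto intro!: poly_bounded_intros simp del: One_nat_def plus_1_eq_Suc)
  ultimately show ?thesis
    by (intro ptime_storeI[where c = "Assign 0 b" and T = "\<lambda>x. 1 + data_size (F x)"]) force+
qed

lemma ptime_store_comp:
  assumes F: "ptime_store F" and G: "ptime_store G" shows "ptime_store (\<lambda>x. G (F x))"
proof -
  obtain c T where T: "poly_bounded data_size T"
    and c: "\<And>s. \<exists>t s'. exec c s t s' \<and> s' 0 = F (s 0) \<and> t \<le> T (s 0)"
    using ptime_storeE[OF F] by metis
  obtain c' T' where T': "poly_bounded data_size T'"
    and c': "\<And>s. \<exists>t s'. exec c' s t s' \<and> s' 0 = G (s 0) \<and> t \<le> T' (s 0)"
    using ptime_storeE[OF G] by metis
  show ?thesis
  proof (rule ptime_storeI[where c = "Seq c c'" and T = "\<lambda>x. T x + T' (F x)"])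
    fix s
    show "\<exists>t s'. exec (Seq c c') s t s' \<and> s' 0 = G (F (s 0)) \<and> t \<le> T (s 0) + T' (F (s 0))"
      using c[of s] c' by (metis exec.Seq add_mono)
  qed (intro poly_bounded_intros T poly_bounded_compose[OF T'] ptime_store_size F)
qed

lemma ptime_store_cond:
  assumes F: "ptime_store F" and G: "ptime_store G" and b: "\<And>s. eval b s = B (s 0)"
  shows "ptime_store (\<lambda>x. if B x \<noteq> Leaf then F x else G x)"
proof -
  obtain c T where T: "poly_bounded data_size T"
    and c: "\<And>s. \<exists>t s'. exec c s t s' \<and> s' 0 = F (s 0) \<and> t \<le> T (s 0)"
    using ptime_storeE[OF F] by metis
  obtain c' T' where T': "poly_bounded data_size T'"
    and c': "\<And>s. \<exists>t s'. exec c' s t s' \<and> s' 0 = G (s 0) \<and> t \<le> T' (s 0)"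
    using ptime_storeE[OF G] by metis
  show ?thesis
  proof (rule ptime_storeI[where c = "Cond b c c'" and T = "\<lambda>x. 1 + (T x + T' x)"])
    fix s
    obtain t s' where 1: "exec c s t s'" "s' 0 = F (s 0)" "t \<le> T (s 0)" using c by blast
    obtain t' s'' where 2: "exec c' s t' s''" "s'' 0 = G (s 0)" "t' \<le> T' (s 0)" using c' by blast
    show "\<exists>t s'. exec (Cond b c c') s t s' \<and> s' 0 = (if B (s 0) \<noteq> Leaf then F (s 0) else G (s 0)) \<and>
        t \<le> 1 + (T (s 0) + T' (s 0))"
    proof (cases "B (s 0) = Leaf")
      case True
      then show ?thesis using exec.CondFalse[of b s c' t' s'' c] 2 b by force
    next
      case False
      then show ?thesis using exec.CondTrue[of b s c t s' c'] 1 b by force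
    qed
  qed (intro poly_bounded_intros T T')
qed

text \<open>Variable 0 is used as a stack: the argument is its top, and whatever the caller has to
  keep lies below it. Hence programs can be combined without renaming variables.\<close>

definition ptime :: "(data \<Rightarrow> data) \<Rightarrow> bool" where
  "ptime f \<longleftrightarrow> ptime_store (\<lambda>d. Node (f (data_hd d)) (data_tl d))"

definition ptime2 :: "(data \<Rightarrow> data \<Rightarrow> data) \<Rightarrow> bool" where
  "ptime2 f \<longleftrightarrow> ptime (\<lambda>z. f (data_hd z) (data_tl z))"

lemma ptime_size:
  assumes "ptime f" shows "poly_bounded data_size (\<lambda>x. data_size (f x))"
proof -
  have "poly_bounded data_size (\<lambda>x. data_size (Node (f (data_hd (Node x Leaf))) (data_tl (Node x Leaf))))"
    by (rule poly_bounded_compose[OF ptime_store_size[OF assms[unfolded ptime_def]],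
          where h = "\<lambda>x. Node x Leaf"])
      (rule poly_bounded_mono[of _ "\<lambda>x. data_size x + 2"]; (intro poly_bounded_intros)?; simp)
  then show ?thesis by (rule poly_bounded_mono) simp
qed

lemma ptime_id: "ptime (\<lambda>x. x)"
  unfolding ptime_def
  by (rule ptime_store_expr[where b = "Cns (Hd (Var 0)) (Tl (Var 0))"]) simp

lemma ptime_comp:
  assumes "ptime g" "ptime f" shows "ptime (\<lambda>x. g (f x))"
  using ptime_store_comp[OF assms(2,1)[unfolded ptime_def]] unfolding ptime_def by simp

lemma ptime_const: "ptime (\<lambda>_. d)"
proof -
  have "\<exists>b. \<forall>s. eval b s = d"
  proof (induction d)
    case Leaf
    have "\<forall>s. eval Nl s = Leaf" by simp
    then show ?case by blast
  next
    case (Node d d')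
    then obtain b b' where "\<forall>s. eval b s = d" "\<forall>s. eval b' s = d'" by blast
    then have "\<forall>s. eval (Cns b b') s = Node d d'" by simp
    then show ?case by blast
  qed
  then obtain b where "\<forall>s. eval b s = d" by blast
  then show ?thesis unfolding ptime_def
    by (intro ptime_store_expr[where b = "Cns b (Tl (Var 0))"]) simp
qed

lemma ptime_hd: "ptime f \<Longrightarrow> ptime (\<lambda>x. data_hd (f x))"
  by (rule ptime_comp[where g = data_hd], unfold ptime_def,
      rule ptime_store_expr[where b = "Cns (Hd (Hd (Var 0))) (Tl (Var 0))"]) simp_all

lemma ptime_tl: "ptime f \<Longrightarrow> ptime (\<lambda>x. data_tl (f x))"
  by (rule ptime_comp[where g = data_tl], unfold ptime_def,
      rule ptime_store_expr[where b = "Cns (Tl (Hd (Var 0))) (Tl (Var 0))"]) simp_all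

text \<open>A sequence of stack operations: duplicate the top, apply \<open>f\<close>, swap the two
  upper entries, apply \<open>g\<close>, pair the results.\<close>

lemma ptime_Node:
  assumes "ptime f" "ptime g" shows "ptime (\<lambda>x. Node (f x) (g x))"
proof -
  have 1: "ptime_store (\<lambda>d. Node (data_hd d) d)"
    by (rule ptime_store_expr[where b = "Cns (Hd (Var 0)) (Var 0)"]) simp
  have 2: "ptime_store (\<lambda>d. Node (data_hd (data_tl d)) (Node (data_hd d) (data_tl (data_tl d))))"
    by (rule ptime_store_expr[where
          b = "Cns (Hd (Tl (Var 0))) (Cns (Hd (Var 0)) (Tl (Tl (Var 0))))"]) simp
  have 3: "ptime_store (\<lambda>d. Node (Node (data_hd (data_tl d)) (data_hd d)) (data_tl (data_tl d)))"
    by (rule ptime_store_expr[where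
          b = "Cns (Cns (Hd (Tl (Var 0))) (Hd (Var 0))) (Tl (Tl (Var 0)))"]) simp
  show ?thesis
    using ptime_store_comp[OF ptime_store_comp[OF ptime_store_comp[OF ptime_store_comp[OF 1
            assms(1)[unfolded ptime_def]] 2] assms(2)[unfolded ptime_def]] 3]
    by (simp add: ptime_def)
qed

definition data_if :: "data \<Rightarrow> data \<Rightarrow> data \<Rightarrow> data" where
  "data_if c a b = (if c \<noteq> Leaf then a else b)"

lemma ptime_if:
  assumes "ptime p" "ptime f" "ptime g" shows "ptime (\<lambda>x. data_if (p x) (f x) (g x))"
proof -
  have 1: "ptime_store (\<lambda>d. Node (data_hd d) d)"
    by (rule ptime_store_expr[where b = "Cns (Hd (Var 0)) (Var 0)"]) simp
  have 2: "ptime_store data_tl"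
    by (rule ptime_store_expr[where b = "Tl (Var 0)"]) simp
  have 3: "ptime_store (\<lambda>d. if data_hd d \<noteq> Leaf then Node (f (data_hd (data_tl d))) (data_tl (data_tl d))
      else Node (g (data_hd (data_tl d))) (data_tl (data_tl d)))"
    by (rule ptime_store_cond[where b = "Hd (Var 0)",
          OF ptime_store_comp[OF 2 assms(2)[unfolded ptime_def]]
             ptime_store_comp[OF 2 assms(3)[unfolded ptime_def]]]) simp
  have eq: "Node (data_if c a b) r = (if c \<noteq> Leaf then Node a r else Node b r)" for c a b r
    by (simp add: data_if_def)
  show ?thesis
    using ptime_store_comp[OF ptime_store_comp[OF 1 assms(1)[unfolded ptime_def]] 3]
    unfolding ptime_def eq by (simp cong: if_cong)
qed

lemma ptime2_app:
  assumes "ptime2 h" "ptime f" "ptime g" shows "ptime (\<lambda>x. h (f x) (g x))"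
  using ptime_comp[OF assms(1)[unfolded ptime2_def] ptime_Node[OF assms(2,3)]] by simp

section \<open>Loops: folds over lists\<close>

fun data_fold :: "(data \<Rightarrow> data \<Rightarrow> data) \<Rightarrow> data \<Rightarrow> data \<Rightarrow> data" where
  "data_fold h a Leaf = a"
| "data_fold h a (Node e l) = data_fold h (h e a) l"

text \<open>\<open>F x a\<close> exceeds the accumulator \<open>a\<close> by an amount polynomial in \<open>x\<close> alone; this is
  the condition under which a fold stays polynomial.\<close>

definition additive :: "(data \<Rightarrow> data \<Rightarrow> data) \<Rightarrow> bool" where
  "additive F \<longleftrightarrow> (\<exists>q. poly_bounded data_size q \<and> (\<forall>x a. data_size (F x a) \<le> data_size a + q x))"

lemma additiveI:
  assumes "\<And>x a. data_size (F x a) \<le> data_size a + q x" "poly_bounded data_size q"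
  shows "additive F"
  using assms unfolding additive_def by blast

lemma data_size_fold_le:
  assumes "\<And>e a. data_size e \<le> data_size l \<Longrightarrow> data_size (h e a) \<le> data_size a + Q"
  shows "data_size (data_fold h a l) \<le> data_size a + data_size l * Q"
  using assms
proof (induction l arbitrary: a)
  case Leaf
  then show ?case by simp
next
  case (Node e l)
  have "data_size (data_fold h (h e a) l) \<le> data_size (h e a) + data_size l * Q"
    by (rule Node.IH(2)) (use Node.prems in auto)
  also have "\<dots> \<le> data_size a + Q + data_size l * Q"
    using Node.prems[of e a] by simp
  also have "\<dots> \<le> data_size a + data_size (Node e l) * Q"
    by (simp add: algebra_simps)
  finally show ?case by simp
qed

lemma additive_acc: "additive (\<lambda>x a. a)"
  by (rule additiveI[where q = "\<lambda>_. 0"]) (auto intro: poly_bounded_const)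

lemma additive_ptime: "ptime f \<Longrightarrow> additive (\<lambda>x a. f x)"
  by (rule additiveI[where q = "\<lambda>x. data_size (f x)"]) (auto intro: ptime_size)

lemma additive_Node:
  assumes "ptime f" "additive F" shows "additive (\<lambda>x a. Node (f x) (F x a))"
proof -
  obtain q where q: "poly_bounded data_size q" "\<And>x a. data_size (F x a) \<le> data_size a + q x"
    using assms(2) unfolding additive_def by blast
  show ?thesis
  proof (rule additiveI[where q = "\<lambda>x. 1 + data_size (f x) + q x"])
    fix x a show "data_size (Node (f x) (F x a)) \<le> data_size a + (1 + data_size (f x) + q x)"
      using q(2)[of x a] by simp
  qed (intro poly_bounded_intros ptime_size assms(1) q(1))
qed

lemma additive_tl:
  assumes "additive F" shows "additive (\<lambda>x a. data_tl (F x a))"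
  using assms unfolding additive_def by (meson data_size_tl_le order_trans)

lemma additive_if:
  assumes "additive F" "additive G" shows "additive (\<lambda>x a. data_if (p x a) (F x a) (G x a))"
proof -
  obtain q where q: "poly_bounded data_size q" "\<And>x a. data_size (F x a) \<le> data_size a + q x"
    using assms(1) unfolding additive_def by blast
  obtain r where r: "poly_bounded data_size r" "\<And>x a. data_size (G x a) \<le> data_size a + r x"
    using assms(2) unfolding additive_def by blast
  show ?thesis
  proof (rule additiveI[where q = "\<lambda>x. q x + r x"])
    fix x a show "data_size (data_if (p x a) (F x a) (G x a)) \<le> data_size a + (q x + r x)"
      using q(2)[of x a] r(2)[of x a] by (simp add: data_if_def)
  qed (intro poly_bounded_intros q(1) r(1))
qed

text \<open>Serves nested folds: an inner fold that starts from the outer accumulator still adds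
  only an amount depending on \<open>x\<close>, because the number of rounds and the growth per
  round are both bounded in terms of \<open>C x\<close> and \<open>L x\<close>.\<close>

lemma additive_fold:
  assumes "additive (\<lambda>z a. h (data_hd z) (data_tl z) a)" "ptime C" "ptime L" "additive F"
  shows "additive (\<lambda>x a. data_fold (h (C x)) (F x a) (L x))"
proof -
  obtain q where q: "poly_bounded data_size q"
      "\<And>z a. data_size (h (data_hd z) (data_tl z) a) \<le> data_size a + q z"
    using assms(1) unfolding additive_def by blast
  obtain r where r: "poly_bounded data_size r" "\<And>x a. data_size (F x a) \<le> data_size a + r x"
    using assms(4) unfolding additive_def by blast
  obtain b where b: "\<And>z. q z \<le> (data_size z + 2) ^ b"
    using q(1) unfolding poly_bounded_def by blast
  let ?Q = "\<lambda>x. (data_size (C x) + data_size (L x) + 3) ^ b"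
  show ?thesis
  proof (rule additiveI[where q = "\<lambda>x. r x + data_size (L x) * ?Q x"])
    fix x a
    have "data_size (data_fold (h (C x)) (F x a) (L x)) \<le> data_size (F x a) + data_size (L x) * ?Q x"
    proof (rule data_size_fold_le)
      fix e a assume e: "data_size e \<le> data_size (L x)"
      have "data_size (h (C x) e a) \<le> data_size a + q (Node (C x) e)"
        using q(2)[of "Node (C x) e" a] by simp
      also have "q (Node (C x) e) \<le> (data_size (Node (C x) e) + 2) ^ b" by (rule b)
      also have "\<dots> \<le> ?Q x" using e by (intro power_mono) auto
      finally show "data_size (h (C x) e a) \<le> data_size a + ?Q x" by simp
    qed
    then show "data_size (data_fold (h (C x)) (F x a) (L x)) \<le> data_size a + (r x + data_size (L x) * ?Q x)"
      using r(2)[of x a] by simp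
  qed (intro poly_bounded_intros r(1) ptime_size assms(2,3))
qed

text \<open>The loop keeps context, accumulator and remaining list on top of the stack and consumes
  one entry per round. Additivity rules out repeated multiplication of the accumulator's size, so
  all rounds share one polynomial time bound. The context \<open>C x\<close> is passed explicitly
  because the step is a fixed program and cannot refer to \<open>x\<close>.\<close>

lemma ptime_fold:
  assumes step: "ptime (\<lambda>z. h (data_hd z) (data_hd (data_tl z)) (data_tl (data_tl z)))"
    and add: "additive (\<lambda>z a. h (data_hd z) (data_tl z) a)"
    and C: "ptime C" and A: "ptime A" and L: "ptime L"
  shows "ptime (\<lambda>x. data_fold (h (C x)) (A x) (L x))"
proof -
  let ?V = "Var 0"
  let ?H = "\<lambda>z. h (data_hd z) (data_hd (data_tl z)) (data_tl (data_tl z))"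
  define body where "body d =
    (let c = data_hd (data_hd d); a = data_hd (data_tl (data_hd d)); l = data_tl (data_tl (data_hd d))
     in Node (Node c (Node (h c (data_hd l) a) (data_tl l))) (data_tl d))" for d
  have "ptime_store body"
  proof -
    have 1: "ptime_store (\<lambda>d. Node (Node (data_hd (data_hd d)) (Node (data_hd (data_tl (data_tl (data_hd d))))
        (data_hd (data_tl (data_hd d))))) (Node (Node (data_hd (data_hd d)) (data_tl (data_tl (data_tl (data_hd d))))) (data_tl d)))"
      by (rule ptime_store_expr[where b = "Cns (Cns (Hd (Hd ?V)) (Cns (Hd (Tl (Tl (Hd ?V)))) (Hd (Tl (Hd ?V)))))
        (Cns (Cns (Hd (Hd ?V)) (Tl (Tl (Tl (Hd ?V))))) (Tl ?V))"]) simp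
    have 2: "ptime_store (\<lambda>d. Node (Node (data_hd (data_hd (data_tl d))) (Node (data_hd d) (data_tl (data_hd (data_tl d)))))
        (data_tl (data_tl d)))"
      by (rule ptime_store_expr[where b = "Cns (Cns (Hd (Hd (Tl ?V))) (Cns (Hd ?V) (Tl (Hd (Tl ?V))))) (Tl (Tl ?V))"]) simp
    show ?thesis
      using ptime_store_comp[OF ptime_store_comp[OF 1 step[unfolded ptime_def]] 2]
      by (simp add: body_def[abs_def] Let_def)
  qed
  then obtain bc T where T: "poly_bounded data_size T"
    and bc: "\<And>s. \<exists>t s'. exec bc s t s' \<and> s' 0 = body (s 0) \<and> t \<le> T (s 0)"
    using ptime_storeE by metis
  obtain e where e: "\<And>x. T x \<le> (data_size x + 2) ^ e"
    using T unfolding poly_bounded_def by blast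
  obtain q where q: "poly_bounded data_size q"
      "\<And>z a. data_size (h (data_hd z) (data_tl z) a) \<le> data_size a + q z"
    using add unfolding additive_def by blast
  obtain b where b: "\<And>z. q z \<le> (data_size z + 2) ^ b"
    using q(1) unfolding poly_bounded_def by blast
  let ?test = "Tl (Tl (Hd ?V))"
  \<comment> \<open>\<open>W\<close> bounds the whole stack in every round: the term
    \<open>data_size l * Q\<close> is a budget for the future growth of the accumulator, of which
    each round spends at most \<open>Q\<close> and gives up at least that much. The 5 consists of
    three nodes of the stack and the 2 from \<open>poly_bounded\<close>.\<close>
  have loop: "\<exists>t s'. exec (While ?test bc) s t s' \<and>
      s' 0 = Node (Node c (Node (data_fold (h c) a l) Leaf)) r \<and>
      t \<le> 1 + data_size l * (1 + W ^ e)"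
    if "s 0 = Node (Node c (Node a l)) r"
      "\<And>e a. data_size e \<le> data_size l \<Longrightarrow> data_size (h c e a) \<le> data_size a + Q"
      "data_size c + data_size a + data_size l * Q + data_size l + data_size r + 5 \<le> W" for s c a l r Q W
    using that
  proof (induction l arbitrary: s a)
    case Leaf
    then show ?case using exec.WhileFalse[of ?test s bc] by (intro exI[of _ 1] exI[of _ s]) simp
  next
    case (Node x l)
    obtain t1 s1 where 1: "exec bc s t1 s1" "s1 0 = body (s 0)" "t1 \<le> T (s 0)"
      using bc by blast
    have s1: "s1 0 = Node (Node c (Node (h c x a) l)) r"
      using 1(2) Node.prems(1) by (simp add: body_def)
    have "T (s 0) \<le> (data_size (s 0) + 2) ^ e" by (rule e)
    also have "\<dots> \<le> W ^ e"
    proof (rule power_mono)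
      show "data_size (s 0) + 2 \<le> W"
        using Node.prems(1,3) by (simp add: algebra_simps)
    qed simp
    finally have t1: "t1 \<le> W ^ e" using 1(3) by simp
    have "data_size (h c x a) \<le> data_size a + Q" by (rule Node.prems(2)) simp
    moreover have "data_size (Node x l) * Q = Q + data_size x * Q + data_size l * Q"
      by (simp add: algebra_simps)
    ultimately have W: "data_size c + data_size (h c x a) + data_size l * Q + data_size l + data_size r + 5 \<le> W"
      using Node.prems(3) by simp
    have "\<exists>t s'. exec (While ?test bc) s1 t s' \<and>
      s' 0 = Node (Node c (Node (data_fold (h c) (h c x a) l) Leaf)) r \<and>
      t \<le> 1 + data_size l * (1 + W ^ e)"
      using Node.prems(2) by (intro Node.IH(2) s1 W) auto
    then obtain t2 s2 where 2: "exec (While ?test bc) s1 t2 s2"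
        "s2 0 = Node (Node c (Node (data_fold (h c) (h c x a) l) Leaf)) r"
        "t2 \<le> 1 + data_size l * (1 + W ^ e)" by blast
    have "eval ?test s \<noteq> Leaf" using Node.prems(1) by simp
    from exec.WhileTrue[OF this 1(1) 2(1)]
    have ex: "exec (While ?test bc) s (1 + t1 + t2) s2" .
    have "1 + t1 + t2 \<le> 1 + (1 + data_size l) * (1 + W ^ e)"
      using t1 2(3) by (simp add: algebra_simps)
    also have "\<dots> \<le> 1 + data_size (Node x l) * (1 + W ^ e)"
      by (intro add_left_mono mult_right_mono) auto
    finally show ?case using ex 2(2) by auto
  qed
  \<comment> \<open>Rebuilding the top from its selectors forces it into the shape of a triple, so
    the loop also behaves as stated on malformed arguments.\<close>
  let ?init = "Assign 0 (Cns (Cns (Hd (Hd ?V)) (Cns (Hd (Tl (Hd ?V))) (Tl (Tl (Hd ?V))))) (Tl ?V))"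
  let ?Q = "\<lambda>d. (2 * data_size d + 10) ^ b"
  let ?W = "\<lambda>d. 5 * data_size d + data_size d * ?Q d + 20"
  have "ptime_store (\<lambda>d. Node (Node (data_hd (data_hd d)) (Node (data_fold (h (data_hd (data_hd d)))
      (data_hd (data_tl (data_hd d))) (data_tl (data_tl (data_hd d)))) Leaf)) (data_tl d))"
  proof (rule ptime_storeI[where c = "Seq ?init (While ?test bc)" and
        T = "\<lambda>d. (10 + 4 * data_size d) + (1 + data_size d * (1 + ?W d ^ e))"])
    fix s :: store
    define d where "d = s 0"
    define c a l r where car: "c = data_hd (data_hd d)" "a = data_hd (data_tl (data_hd d))"
      "l = data_tl (data_tl (data_hd d))" "r = data_tl d"
    have sz: "data_size c \<le> data_size d" "data_size a \<le> data_size d" "data_size l \<le> data_size d"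
        "data_size r \<le> data_size d"
      unfolding car by (meson data_size_hd_le data_size_tl_le order_trans)+
    let ?s1 = "s(0 := Node (Node c (Node a l)) r)"
    have init: "exec ?init s (1 + data_size (Node (Node c (Node a l)) r)) ?s1"
      using exec.Assign[of 0 "Cns (Cns (Hd (Hd ?V)) (Cns (Hd (Tl (Hd ?V))) (Tl (Tl (Hd ?V))))) (Tl ?V)" s]
      by (simp add: car d_def)
    have lQ: "data_size l * ?Q d \<le> data_size d * ?Q d" using sz by simp
    obtain t s' where t: "exec (While ?test bc) ?s1 t s'"
        "s' 0 = Node (Node c (Node (data_fold (h c) a l) Leaf)) r"
        "t \<le> 1 + data_size l * (1 + ?W d ^ e)"
    proof (atomize_elim, intro loop[where Q = "?Q d"])
      fix x a assume x: "data_size x \<le> data_size l"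
      have "data_size (h c x a) \<le> data_size a + q (Node c x)"
        using q(2)[of "Node c x" a] by simp
      also have "q (Node c x) \<le> (data_size (Node c x) + 2) ^ b" by (rule b)
      also have "\<dots> \<le> ?Q d" using x sz by (intro power_mono) auto
      finally show "data_size (h c x a) \<le> data_size a + ?Q d" by simp
    qed (simp, use sz lQ in linarith)
    have "1 + data_size (Node (Node c (Node a l)) r) + t \<le>
        (10 + 4 * data_size d) + (1 + data_size d * (1 + ?W d ^ e))"
    proof (rule add_mono)
      show "1 + data_size (Node (Node c (Node a l)) r) \<le> 10 + 4 * data_size d"
        using sz by simp
      show "t \<le> 1 + data_size d * (1 + ?W d ^ e)"
        using t(3) mult_right_mono[OF sz(3), of "1 + ?W d ^ e"] by simp
    qed
    then show "\<exists>t s'. exec (Seq ?init (While ?test bc)) s t s' \<and>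
        s' 0 = Node (Node (data_hd (data_hd (s 0))) (Node (data_fold (h (data_hd (data_hd (s 0))))
      (data_hd (data_tl (data_hd (s 0)))) (data_tl (data_tl (data_hd (s 0))))) Leaf)) (data_tl (s 0)) \<and>
        t \<le> (10 + 4 * data_size (s 0)) + (1 + data_size (s 0) * (1 + ?W (s 0) ^ e))"
      using exec.Seq[OF init t(1)] t(2) unfolding d_def[symmetric] car by blast
  qed (intro poly_bounded_intros)
  then have 1: "ptime (\<lambda>z. Node (data_hd z) (Node (data_fold (h (data_hd z))
      (data_hd (data_tl z)) (data_tl (data_tl z))) Leaf))"
    unfolding ptime_def .
  show ?thesis
    using ptime_hd[OF ptime_tl[OF ptime_comp[OF 1 ptime_Node[OF C ptime_Node[OF A L]]]]] by simp
qed

lemmas ptime_intros = ptime_id ptime_const ptime_hd ptime_tl ptime_Node ptime_if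

section \<open>Boolean connectives and unary arithmetic\<close>

definition data_not :: "data \<Rightarrow> data" where
  "data_not a = data_if a Leaf (data_of_bool True)"

definition data_and :: "data \<Rightarrow> data \<Rightarrow> data" where
  "data_and a b = data_if a b Leaf"

definition data_or :: "data \<Rightarrow> data \<Rightarrow> data" where
  "data_or a b = data_if a (data_of_bool True) b"

lemma data_of_bool_eq_Leaf [simp]: "data_of_bool b = Leaf \<longleftrightarrow> \<not> b"
  by (simp add: data_of_bool_def)

lemma data_if_bool [simp]: "data_if (data_of_bool b) x y = (if b then x else y)"
  by (simp add: data_if_def)

lemma data_connectives [simp]:
  "data_not (data_of_bool b) = data_of_bool (\<not> b)"
  "data_and (data_of_bool b) (data_of_bool b') = data_of_bool (b \<and> b')"
  "data_or (data_of_bool b) (data_of_bool b') = data_of_bool (b \<or> b')"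
  by (auto simp: data_not_def data_and_def data_or_def data_of_bool_def data_if_def)

lemma ptime_not: "ptime f \<Longrightarrow> ptime (\<lambda>x. data_not (f x))"
  unfolding data_not_def by (intro ptime_intros)

lemma ptime_and: "ptime f \<Longrightarrow> ptime g \<Longrightarrow> ptime (\<lambda>x. data_and (f x) (g x))"
  unfolding data_and_def by (intro ptime_intros)

lemma ptime_or: "ptime f \<Longrightarrow> ptime g \<Longrightarrow> ptime (\<lambda>x. data_or (f x) (g x))"
  unfolding data_or_def by (intro ptime_intros)

text \<open>Every tree is read as the number given by the length of its right spine, so comparisons
  need no side condition on their arguments. In particular the input string itself can be used as
  the number \<open>length x\<close>.\<close>

fun data_length :: "data \<Rightarrow> nat" where
  "data_length Leaf = 0"
| "data_length (Node a b) = Suc (data_length b)"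

lemma data_length_of_list [simp]: "data_length (data_of_list f xs) = length xs"
  by (induction xs) auto

lemma data_of_nat_simps [simp]:
  "data_of_nat 0 = Leaf" "data_of_nat (Suc n) = Node Leaf (data_of_nat n)"
  by (auto simp: data_of_nat_def)

lemma data_length_of_nat [simp]: "data_length (data_of_nat n) = n"
  by (induction n) auto

lemma data_size_of_nat [simp]: "data_size (data_of_nat n) = 2 * n + 1"
  by (induction n) auto

lemma data_fold_of_list: "data_fold h a (data_of_list f xs) = fold (\<lambda>x. h (f x)) xs a"
  by (induction xs arbitrary: a) auto

lemma data_fold_const: "data_fold (\<lambda>_. h) a l = (h ^^ data_length l) a"
  by (induction l arbitrary: a) (auto simp: funpow_swap1)

definition data_drop :: "data \<Rightarrow> data \<Rightarrow> data" where
  "data_drop a b = data_fold (\<lambda>_ x. data_tl x) a b"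

lemma ptime_drop:
  assumes "ptime f" "ptime g" shows "ptime (\<lambda>x. data_drop (f x) (g x))"
  unfolding data_drop_def
  by (rule ptime_fold[where h = "\<lambda>_ _ x. data_tl x" and C = "\<lambda>_. Leaf"])
    (intro ptime_intros additive_tl additive_acc assms)+

lemma data_length_drop [simp]: "data_length (data_drop a b) = data_length a - data_length b"
proof -
  have "data_length (data_tl d) = data_length d - 1" for d by (cases d) auto
  then have "data_length ((data_tl ^^ n) a) = data_length a - n" for n by (induction n) auto
  then show ?thesis by (simp add: data_drop_def data_fold_const)
qed

lemma data_length_eq_0 [simp]: "data_length d = 0 \<longleftrightarrow> d = Leaf"
  by (cases d) auto

lemma data_drop_of_nat [simp]: "data_drop (data_of_nat m) b = data_of_nat (m - data_length b)"
proof -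
  have "data_tl (data_of_nat n) = data_of_nat (n - 1)" for n by (cases n) auto
  then have "(data_tl ^^ n) (data_of_nat m) = data_of_nat (m - n)" for n by (induction n) auto
  then show ?thesis by (simp add: data_drop_def data_fold_const)
qed

definition data_le :: "data \<Rightarrow> data \<Rightarrow> data" where
  "data_le a b = data_not (data_drop a b)"

lemma data_le [simp]: "data_le a b = data_of_bool (data_length a \<le> data_length b)"
proof -
  have "data_drop a b = Leaf \<longleftrightarrow> data_length a \<le> data_length b"
    using data_length_drop[of a b] data_length_eq_0[of "data_drop a b"] by linarith
  then show ?thesis by (simp add: data_le_def data_not_def data_if_def data_of_bool_def)
qed

lemma ptime_le: "ptime f \<Longrightarrow> ptime g \<Longrightarrow> ptime (\<lambda>x. data_le (f x) (g x))"
  unfolding data_le_def by (intro ptime_not ptime_drop)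

definition data_eq :: "data \<Rightarrow> data \<Rightarrow> data" where
  "data_eq a b = data_and (data_le a b) (data_le b a)"

lemma data_eq [simp]: "data_eq a b = data_of_bool (data_length a = data_length b)"
  by (simp add: data_eq_def eq_iff)

lemma ptime_eq: "ptime f \<Longrightarrow> ptime g \<Longrightarrow> ptime (\<lambda>x. data_eq (f x) (g x))"
  unfolding data_eq_def by (intro ptime_and ptime_le)

definition data_add :: "data \<Rightarrow> data \<Rightarrow> data" where
  "data_add a b = data_fold (\<lambda>_ x. Node Leaf x) a b"

lemma data_add [simp]: "data_add (data_of_nat m) b = data_of_nat (m + data_length b)"
proof -
  have "(Node Leaf ^^ n) (data_of_nat m) = data_of_nat (m + n)" for n by (induction n) auto
  then show ?thesis by (simp add: data_add_def data_fold_const)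
qed

lemma ptime_add:
  assumes "ptime f" "ptime g" shows "ptime (\<lambda>x. data_add (f x) (g x))"
  unfolding data_add_def
  by (rule ptime_fold[where h = "\<lambda>_ _ x. Node Leaf x" and C = "\<lambda>_. Leaf"])
    (intro ptime_intros additive_Node additive_acc assms)+

lemma additive_add:
  assumes "ptime g" "additive F" shows "additive (\<lambda>x a. data_add (F x a) (g x))"
  unfolding data_add_def
  by (rule additive_fold[where h = "\<lambda>_ _ x. Node Leaf x" and C = "\<lambda>_. Leaf"])
    (intro ptime_intros additive_Node additive_acc assms)+

definition data_mult :: "data \<Rightarrow> data \<Rightarrow> data" where
  "data_mult a b = data_fold (\<lambda>_ x. data_add x a) Leaf b"

lemma data_mult [simp]: "data_mult a b = data_of_nat (data_length a * data_length b)"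
proof -
  have "((\<lambda>x. data_add x a) ^^ n) (data_of_nat 0) = data_of_nat (data_length a * n)" for n
    by (induction n) (auto simp: algebra_simps simp del: data_of_nat_simps)
  then show ?thesis by (simp add: data_mult_def data_fold_const)
qed

lemma ptime_mult:
  assumes "ptime f" "ptime g" shows "ptime (\<lambda>x. data_mult (f x) (g x))"
  unfolding data_mult_def
  by (rule ptime_fold[where h = "\<lambda>a _ x. data_add x a" and C = f])
    (intro ptime_intros ptime_add additive_add additive_acc assms)+

text \<open>The exponent belongs to the program and not to its input: each \<open>n\<close> yields a
  fixed composition of multiplications. A fold that multiplies its accumulator would not be
  additive.\<close>

primrec data_power :: "data \<Rightarrow> nat \<Rightarrow> data" where
  "data_power a 0 = data_of_nat 1"
| "data_power a (Suc n) = data_mult a (data_power a n)"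

lemma data_power [simp]: "data_power a n = data_of_nat (data_length a ^ n)"
  by (induction n) auto

lemma ptime_power: "ptime f \<Longrightarrow> ptime (\<lambda>x. data_power (f x) n)"
  by (induction n) (auto intro!: ptime_intros ptime_mult simp del: data_mult data_power
      simp: ptime_mult)

lemmas ptime_arith = ptime_intros ptime_not ptime_and ptime_or ptime_drop ptime_le ptime_eq
  ptime_add ptime_mult ptime_power

section \<open>Composing fpt-reductions with polynomial-time reductions\<close>

fun expr_vars :: "expr \<Rightarrow> nat set" where
  "expr_vars (Var x) = {x}"
| "expr_vars Nl = {}"
| "expr_vars (Cns a b) = expr_vars a \<union> expr_vars b"
| "expr_vars (Hd a) = expr_vars a"
| "expr_vars (Tl a) = expr_vars a"

fun com_vars :: "com \<Rightarrow> nat set" where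
  "com_vars Skip = {}"
| "com_vars (Assign x e) = insert x (expr_vars e)"
| "com_vars (Seq c c') = com_vars c \<union> com_vars c'"
| "com_vars (Cond e c c') = expr_vars e \<union> com_vars c \<union> com_vars c'"
| "com_vars (While e c) = expr_vars e \<union> com_vars c"

lemma finite_com_vars: "finite (com_vars c)"
proof -
  have "finite (expr_vars e)" for e by (induction e) auto
  then show ?thesis by (induction c) auto
qed

lemma eval_cong: "(\<And>y. y \<in> expr_vars e \<Longrightarrow> s y = s' y) \<Longrightarrow> eval e s = eval e s'"
  by (induction e) auto

text \<open>A program obtained from \<open>computable\<close> is arbitrary and may overwrite its
  input. A variable outside \<open>com_vars c\<close> carries a value safely across its run.\<close>

lemma exec_fresh:
  assumes "exec c s t s'" "m \<notin> com_vars c"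
  shows "exec c (s(m := d)) t (s'(m := d))"
  using assms
proof (induction rule: exec.induct)
  case (Assign x e s)
  then have "eval e (s(m := d)) = eval e s" by (intro eval_cong) auto
  moreover have "(s(m := d))(x := eval e s) = (s(x := eval e s))(m := d)"
    using Assign by (auto simp: fun_upd_twist)
  ultimately show ?case using exec.Assign[of x e "s(m := d)"] by metis
next
  case (CondTrue e s c1 t s1 c2)
  then have "eval e (s(m := d)) = eval e s" by (intro eval_cong) auto
  then show ?case using CondTrue exec.CondTrue[of e "s(m := d)" c1] by (metis UnCI com_vars.simps(4))
next
  case (CondFalse e s c2 t s1 c1)
  then have "eval e (s(m := d)) = eval e s" by (intro eval_cong) auto
  then show ?case using CondFalse exec.CondFalse[of e "s(m := d)" c2] by (metis UnCI com_vars.simps(4))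
next
  case (WhileFalse e s c)
  then have "eval e (s(m := d)) = eval e s" by (intro eval_cong) auto
  then show ?case using WhileFalse exec.WhileFalse[of e "s(m := d)" c] by metis
next
  case (WhileTrue e s c t1 s1 t2 s2)
  then have "eval e (s(m := d)) = eval e s" by (intro eval_cong) auto
  then show ?case using WhileTrue exec.WhileTrue[of e "s(m := d)" c t1 "s1(m := d)" t2 "s2(m := d)"]
    by (metis UnCI com_vars.simps(5))
next
  case (Seq c1 s t1 s1 c2 t2 s2)
  then show ?case using exec.Seq[of c1 "s(m := d)" t1 "s1(m := d)" c2 t2 "s2(m := d)"]
    by (metis UnCI com_vars.simps(3))
qed (rule exec.Skip)

lemma ptime_program:
  assumes "ptime f"
  obtains c e where "\<And>s. \<exists>t s'. exec c s t s' \<and> s' 0 = f (s 0) \<and> t \<le> (data_size (s 0) + 2) ^ e"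
proof -
  have 1: "ptime_store (\<lambda>d. Node d Leaf)"
    by (rule ptime_store_expr[where b = "Cns (Var 0) Nl"]) simp
  have 2: "ptime_store data_hd"
    by (rule ptime_store_expr[where b = "Hd (Var 0)"]) simp
  have "ptime_store f"
    using ptime_store_comp[OF ptime_store_comp[OF 1 assms[unfolded ptime_def]] 2] by simp
  then obtain c T where T: "poly_bounded data_size T"
    and c: "\<And>s. \<exists>t s'. exec c s t s' \<and> s' 0 = f (s 0) \<and> t \<le> T (s 0)"
    using ptime_storeE by metis
  obtain e where "\<And>x. T x \<le> (data_size x + 2) ^ e"
    using T unfolding poly_bounded_def by blast
  with c that show ?thesis by (meson order_trans)
qed

text \<open>The time bound of a composed reduction involves both \<open>f k\<close> and
  \<open>k\<close>, so \<open>k\<close> is saved in a fresh variable before \<open>f k\<close> is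
  computed.\<close>

lemma computable_ptime_pair:
  assumes f: "computable f" and h: "ptime h"
    and hg: "\<And>k. h (Node (data_of_nat (f k)) (data_of_nat k)) = data_of_nat (g k)"
  shows "computable g"
proof -
  obtain c where c: "\<And>k. \<exists>t. computes_in c (data_of_nat k) t (data_of_nat (f k))"
    using f unfolding computable_def by blast
  obtain ch e where ch: "\<And>s. \<exists>t s'. exec ch s t s' \<and> s' 0 = h (s 0) \<and> t \<le> (data_size (s 0) + 2) ^ e"
    using ptime_program[OF h] by metis
  obtain m where "m \<notin> insert 0 (com_vars c)"
    using finite_com_vars[of c] by (metis ex_new_if_finite finite_insert infinite_UNIV_nat)
  then have m: "m \<noteq> 0" "m \<notin> com_vars c" by auto
  let ?c = "Seq (Assign m (Var 0)) (Seq c (Seq (Assign 0 (Cns (Var 0) (Var m))) ch))"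
  have "\<exists>t. computes_in ?c (data_of_nat k) t (data_of_nat (g k))" for k
  proof -
    let ?s = "(\<lambda>_. Leaf)(0 := data_of_nat k)"
    obtain t s where s: "exec c ?s t s" "s 0 = data_of_nat (f k)"
      using c[of k] unfolding computes_in_def by blast
    have 1: "\<exists>t. exec (Assign m (Var 0)) ?s t (?s(m := data_of_nat k))"
      using exec.Assign[of m "Var 0" ?s] by auto
    have 2: "exec c (?s(m := data_of_nat k)) t (s(m := data_of_nat k))"
      using exec_fresh[OF s(1) m(2)] .
    let ?s2 = "(s(m := data_of_nat k))(0 := Node (data_of_nat (f k)) (data_of_nat k))"
    have 3: "\<exists>t. exec (Assign 0 (Cns (Var 0) (Var m))) (s(m := data_of_nat k)) t ?s2"
      using exec.Assign[of 0 "Cns (Var 0) (Var m)" "s(m := data_of_nat k)"] s(2) m by auto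
    obtain t' s3 where "exec ch ?s2 t' s3" "s3 0 = data_of_nat (g k)"
      using ch[of ?s2] hg by auto
    with 1 2 3 show ?thesis unfolding computes_in_def by (meson exec.Seq)
  qed
  then show ?thesis unfolding computable_def by blast
qed

lemma data_size_instance_le:
  "data_size (data_of_instance x k) + 2 \<le> (2 * k + 5) * (length x + 1)"
proof -
  have "data_size (data_of_list data_of_bool x) \<le> 4 * length x + 1"
    by (induction x) (auto simp: data_of_bool_def)
  then show ?thesis by (simp add: data_of_instance_def algebra_simps)
qed

text \<open>The intermediate instance is no larger than the input plus the time of the first
  reduction, and a polynomial applied to an fpt bound is again an fpt bound. Monotonicity of
  \<open>G\<close> is used because the intermediate parameter is known only through its bound
  \<open>g k\<close>.\<close>

lemma fpt_reducible_ptime: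
  assumes AB: "fpt_reducible A B" and R: "ptime R" and H: "ptime H"
    and HG: "\<And>k. H (data_of_nat k) = data_of_nat (G k)" and G: "mono G"
    and BC: "\<And>x k. \<exists>x' k'. R (data_of_instance x k) = data_of_instance x' k' \<and> k' \<le> G k \<and>
      ((x, k) \<in> B \<longleftrightarrow> (x', k') \<in> C)"
  shows "fpt_reducible A C"
proof -
  obtain c f g e where f: "computable f" and g: "computable g"
    and c: "\<And>x k. \<exists>x' k' t. computes_in c (data_of_instance x k) t (data_of_instance x' k') \<and>
        t \<le> f k * (length x + 1) ^ e \<and> k' \<le> g k \<and> ((x, k) \<in> A \<longleftrightarrow> (x', k') \<in> B)"
    using AB unfolding fpt_reducible_def by blast
  obtain cr er where cr: "\<And>s. \<exists>t s'. exec cr s t s' \<and> s' 0 = R (s 0) \<and> t \<le> (data_size (s 0) + 2) ^ er"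
    using ptime_program[OF R] by metis
  let ?u = "\<lambda>k. 2 * k + 5 + f k"
  let ?f = "\<lambda>k. ?u k ^ (er + 2)"
  have cf: "computable ?f"
  proof (rule computable_ptime_pair[OF f])
    show "ptime (\<lambda>z. data_power (data_add (data_add (data_add (data_of_nat 5) (data_hd z))
        (data_tl z)) (data_tl z)) (er + 2))"
      by (intro ptime_arith)
  qed (simp del: data_of_nat_simps add: algebra_simps)
  have cg: "computable (\<lambda>k. G (g k))"
    by (rule computable_ptime_pair[OF g, where h = "\<lambda>z. H (data_hd z)"])
      (intro ptime_comp[OF H] ptime_intros, simp add: HG)
  have "\<exists>x' k' t. computes_in (Seq c cr) (data_of_instance x k) t (data_of_instance x' k') \<and>
        t \<le> ?f k * (length x + 1) ^ ((e + 1) * (er + 2)) \<and> k' \<le> G (g k) \<and> ((x, k) \<in> A \<longleftrightarrow> (x', k') \<in> C)"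
    for x k
  proof -
    obtain x1 k1 t1 where 1: "computes_in c (data_of_instance x k) t1 (data_of_instance x1 k1)"
        "t1 \<le> f k * (length x + 1) ^ e" "k1 \<le> g k" "(x, k) \<in> A \<longleftrightarrow> (x1, k1) \<in> B"
      using c by blast
    obtain x2 k2 where 2: "R (data_of_instance x1 k1) = data_of_instance x2 k2" "k2 \<le> G k1"
        "(x1, k1) \<in> B \<longleftrightarrow> (x2, k2) \<in> C"
      using BC by blast
    let ?s = "(\<lambda>_. Leaf)(0 := data_of_instance x k)"
    obtain s1 where s1: "exec c ?s t1 s1" "s1 0 = data_of_instance x1 k1"
      using 1(1) unfolding computes_in_def by blast
    obtain t2 s2 where s2: "exec cr s1 t2 s2" "s2 0 = R (s1 0)" "t2 \<le> (data_size (s1 0) + 2) ^ er"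
      using cr by blast
    have comp: "computes_in (Seq c cr) (data_of_instance x k) (t1 + t2) (data_of_instance x2 k2)"
      unfolding computes_in_def using exec.Seq[OF s1(1) s2(1)] s1(2) s2(2) 2(1) by auto
    let ?n = "length x + 1"
    \<comment> \<open>\<open>?w\<close> dominates \<open>t1\<close> as well as the base
      \<open>data_size (s1 0) + 2\<close> of the second time bound. The total is therefore at most
      \<open>?w + ?w ^ er\<close>, which is where the exponent \<open>er + 2\<close> comes
      from.\<close>
    let ?w = "?u k * ?n ^ (e + 1)"
    have n: "?n ^ e \<le> ?n ^ (e + 1)" "?n \<le> ?n ^ (e + 1)"
      using power_increasing[of 1 "e + 1" ?n] power_increasing[of e "e + 1" ?n] by auto
    have t1: "t1 \<le> f k * ?n ^ (e + 1)"
      using 1(2) n(1) by (meson mult_left_mono order_trans zero_le)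
    have "data_size (s1 0) + 2 \<le> data_size (data_of_instance x k) + 2 + t1"
      using exec_data_size[OF s1(1), of 0] by simp
    also have "\<dots> \<le> (2 * k + 5) * ?n + f k * ?n ^ (e + 1)"
      using data_size_instance_le t1 by (intro add_mono)
    also have "\<dots> \<le> (2 * k + 5) * ?n ^ (e + 1) + f k * ?n ^ (e + 1)"
      using n(2) by (intro add_mono mult_left_mono) auto
    finally have "data_size (s1 0) + 2 \<le> ?w" by (simp add: algebra_simps)
    then have t2: "t2 \<le> ?w ^ er" using s2(3) by (meson power_mono order_trans zero_le)
    have "2 \<le> ?u k * 1" by simp
    also have "\<dots> \<le> ?w" by (intro mult_left_mono one_le_power) auto
    finally have w: "2 \<le> ?w" .
    have "t1 \<le> ?w ^ 1" using t1 by (simp add: algebra_simps)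
    with t2 have "t1 + t2 \<le> ?w ^ (1 + er + 1)"
      using power_add_power_le[OF w, of 1 er] by linarith
    also have "\<dots> = ?f k * ?n ^ ((e + 1) * (er + 2))"
      by (simp only: power_mult_distrib power_mult[symmetric]) (simp add: ac_simps)
    finally have "t1 + t2 \<le> ?f k * ?n ^ ((e + 1) * (er + 2))" .
    moreover have "k2 \<le> G (g k)" using 2(2) 1(3) monoD[OF G] order_trans by blast
    ultimately show ?thesis using comp 1(4) 2(3) by blast
  qed
  with cf cg show ?thesis unfolding fpt_reducible_def by blast
qed

section \<open>Acyclic matchings and independent sets\<close>

lemma cycle_in_4I:
  assumes "distinct [a, b, c, d]" "{a, b} \<in> snd G" "{b, c} \<in> snd G" "{c, d} \<in> snd G" "{d, a} \<in> snd G"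
  shows "cycle_in G [a, b, c, d]"
  using assms unfolding cycle_in_def by (auto simp: less_Suc_eq)

text \<open>Every element \<open>e \<in> V\<close> has \<open>t\<close> copies, each of them an edge. The conflict relation \<open>cf\<close> is a union
  of half graphs \<open>\<alpha> r e < \<beta> r e'\<close>. An acyclic matching has at most two edges in a half graph, so
  fewer than \<open>t\<close> of its edges come from conflicts.\<close>

locale conflict_graph =
  fixes W :: "'v set" and V :: "'e set" and t :: nat
    and el :: "'v \<Rightarrow> 'e" and cp :: "'v \<Rightarrow> nat" and sd :: "'v \<Rightarrow> bool"
    and cf :: "'e \<Rightarrow> 'e \<Rightarrow> bool" and R :: "'r set" and \<alpha> \<beta> :: "'r \<Rightarrow> 'e \<Rightarrow> int" and G :: "'v graph"
  assumes bij: "bij_betw (\<lambda>w. (el w, cp w, sd w)) W (V \<times> {..<t} \<times> UNIV)"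
    and finV: "finite V" and finR: "finite R" and R_less: "2 * card R < t"
    and cf_sym: "\<And>e e'. cf e e' \<Longrightarrow> cf e' e"
    and cf_irrefl: "\<And>e. e \<in> V \<Longrightarrow> \<not> cf e e"
    and cf_iff: "\<And>e e'. e \<in> V \<Longrightarrow> e' \<in> V \<Longrightarrow> cf e e' \<longleftrightarrow> (\<exists>r\<in>R. \<alpha> r e < \<beta> r e')"
    and G: "G = (W, {{u, w} | u w. u \<in> W \<and> w \<in> W \<and> sd u \<and> \<not> sd w \<and>
      (el u = el w \<and> cp u = cp w \<or> cf (el u) (el w))})"
begin

lemma vertex_eqI:
  "u \<in> W \<Longrightarrow> w \<in> W \<Longrightarrow> el u = el w \<Longrightarrow> cp u = cp w \<Longrightarrow> sd u = sd w \<Longrightarrow> u = w"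
  using bij unfolding bij_betw_def inj_on_def by blast

lemma vertex_range: "w \<in> W \<Longrightarrow> el w \<in> V \<and> cp w < t"
  using bij unfolding bij_betw_def by blast

lemma finite_W: "finite W"
  using bij finV by (simp add: bij_betw_finite)

lemma edgeE:
  assumes "{x, y} \<in> snd G"
  shows "x \<in> W" "y \<in> W" "sd x \<noteq> sd y" "el x = el y \<and> cp x = cp y \<or> cf (el x) (el y)"
  using assms cf_sym unfolding G by (auto simp: doubleton_eq_iff)

lemma edge_iff:
  "{x, y} \<in> snd G \<longleftrightarrow>
    x \<in> W \<and> y \<in> W \<and> sd x \<noteq> sd y \<and> (el x = el y \<and> cp x = cp y \<or> cf (el x) (el y))"
proof
  assume r: "x \<in> W \<and> y \<in> W \<and> sd x \<noteq> sd y \<and> (el x = el y \<and> cp x = cp y \<or> cf (el x) (el y))"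
  show "{x, y} \<in> snd G"
  proof (cases "sd x")
    case True
    then show ?thesis using r unfolding G by auto
  next
    case False
    then have "{y, x} \<in> snd G" using r cf_sym[of "el x" "el y"] unfolding G snd_conv mem_Collect_eq
      by (intro exI[of _ y] exI[of _ x]) auto
    then show ?thesis by (simp add: insert_commute)
  qed
qed (use edgeE in blast)

lemma simple: "simple_graph G"
  unfolding simple_graph_def using finite_W by (auto simp: G card_2_iff)

lemma bipartite: "bipartite G"
  unfolding bipartite_def
  by (rule exI[of _ "{w \<in> W. sd w}"], rule exI[of _ "{w \<in> W. \<not> sd w}"]) (auto simp: G)

text \<open>All \<open>t\<close> copies of all elements of \<open>E\<close> are taken. Without
  conflicts no further edges are induced among their ends, so the induced subgraph consists of
  disjoint edges.\<close>

lemma independent_imp_acyclic_matching: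
  assumes E: "E \<subseteq> V" and indep: "\<forall>e\<in>E. \<forall>e'\<in>E. \<not> cf e e'"
  shows "\<exists>M. acyclic_matching G M \<and> card M = card E * t"
proof -
  define \<rho> where "\<rho> = inv_into W (\<lambda>w. (el w, cp w, sd w))"
  have \<rho>: "\<rho> (e, s, b) \<in> W" "el (\<rho> (e, s, b)) = e" "cp (\<rho> (e, s, b)) = s" "sd (\<rho> (e, s, b)) = b"
    if "e \<in> V" "s < t" for e s b
  proof -
    have x: "(e, s, b) \<in> (\<lambda>w. (el w, cp w, sd w)) ` W"
      using bij that by (auto simp: bij_betw_def)
    show "\<rho> (e, s, b) \<in> W" unfolding \<rho>_def using inv_into_into[OF x] .
    show "el (\<rho> (e, s, b)) = e" "cp (\<rho> (e, s, b)) = s" "sd (\<rho> (e, s, b)) = b"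
      unfolding \<rho>_def using f_inv_into_f[OF x] by auto
  qed
  let ?m = "\<lambda>(e, s). {\<rho> (e, s, True), \<rho> (e, s, False)}"
  let ?M = "?m ` (E \<times> {..<t})"
  have mem: "el x = e \<and> cp x = s \<and> x \<in> W" if "x \<in> ?m (e, s)" "e \<in> E" "s < t" for x e s
    using that \<rho>[of e s] E by auto
  have inj: "inj_on ?m (E \<times> {..<t})"
  proof (rule inj_onI)
    fix x y assume "x \<in> E \<times> {..<t}" "y \<in> E \<times> {..<t}" "?m x = ?m y"
    moreover have "\<rho> (fst x, snd x, True) \<in> ?m x" by (auto split: prod.split)
    ultimately show "x = y"
      using mem[of "\<rho> (fst x, snd x, True)" "fst x" "snd x"] mem[of "\<rho> (fst x, snd x, True)" "fst y" "snd y"]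
      by (auto simp: mem_Times_iff prod_eq_iff)
  qed
  have "acyclic_graph (induced_subgraph G (\<Union>?M))"
    unfolding acyclic_graph_def
  proof
    assume "\<exists>vs. cycle_in (induced_subgraph G (\<Union>?M)) vs"
    then obtain vs where len: "3 \<le> length vs" and dist: "distinct vs"
      and edge: "\<And>i. i < length vs \<Longrightarrow>
        {vs ! i, vs ! (Suc i mod length vs)} \<in> snd (induced_subgraph G (\<Union>?M))"
      unfolding cycle_in_def by blast
    have twin: "x \<in> W \<and> y \<in> W \<and> sd x \<noteq> sd y \<and> el x = el y \<and> cp x = cp y"
      if "{x, y} \<in> snd (induced_subgraph G (\<Union>?M))" for x y
    proof -
      have xy: "{x, y} \<in> snd G" "x \<in> \<Union>?M" "y \<in> \<Union>?M"
        using that by (auto simp: induced_subgraph_def)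
      have "el z \<in> E" if z: "z \<in> \<Union>?M" for z
      proof -
        obtain e s where "z \<in> ?m (e, s)" "e \<in> E" "s < t" using z by blast
        then show ?thesis using mem[of z e s] by metis
      qed
      then have "\<not> cf (el x) (el y)" using xy indep by blast
      then show ?thesis using edgeE[OF xy(1)] by blast
    qed
    \<comment> \<open>Two consecutive edges of the cycle suffice: \<open>vs ! 0\<close> and
      \<open>vs ! 2\<close> are both the other end of the copy that contains \<open>vs ! 1\<close>,
      hence equal.\<close>
    have "0 < length vs" "1 < length vs" "Suc 0 mod length vs = 1" "Suc 1 mod length vs = 2"
      using len by auto
    then have "{vs ! 0, vs ! 1} \<in> snd (induced_subgraph G (\<Union>?M))"
      "{vs ! 1, vs ! 2} \<in> snd (induced_subgraph G (\<Union>?M))"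
      using edge[of 0] edge[of 1] by metis+
    from this[THEN twin] have "vs ! 0 = vs ! 2" by (intro vertex_eqI) auto
    moreover have "0 < length vs" "2 < length vs" using len by auto
    ultimately show False using nth_eq_iff_index_eq[OF dist, of 0 2] by auto
  qed
  moreover have "matching G ?M"
    unfolding matching_def
  proof (intro conjI ballI impI)
    show "?M \<subseteq> snd G"
    proof
      fix m assume "m \<in> ?M"
      then obtain e s where m: "m = {\<rho> (e, s, True), \<rho> (e, s, False)}" "e \<in> V" "s < t"
        using E by auto
      then show "m \<in> snd G" using \<rho>[OF m(2,3)] unfolding m(1) by (simp add: edge_iff)
    qed
    fix m m' assume "m \<in> ?M" "m' \<in> ?M" "m \<noteq> m'"
    then obtain e s e' s' where m: "m = ?m (e, s)" "e \<in> E" "s < t" "m' = ?m (e', s')" "e' \<in> E" "s' < t"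
      by blast
    show "m \<inter> m' = {}"
    proof (rule ccontr)
      assume "m \<inter> m' \<noteq> {}"
      then obtain x where "x \<in> m" "x \<in> m'" by blast
      then have "e = e'" "s = s'" using mem[of x e s] mem[of x e' s'] m by auto
      then show False using m \<open>m \<noteq> m'\<close> by simp
    qed
  qed
  moreover have "card ?M = card E * t"
    using card_image[OF inj] by (simp add: card_cartesian_product)
  ultimately show ?thesis unfolding acyclic_matching_def by blast
qed

text \<open>\<open>Md\<close> collects the edges that are copies, and \<open>Mr r\<close> the edges
  that lie in the half graph \<open>r\<close>. Fewer than \<open>t\<close> edges are outside
  \<open>Md\<close>, and each element accounts for at most \<open>t\<close> edges inside it, so at
  least \<open>K\<close> elements occur in \<open>Md\<close>. Two of them cannot conflict, since
  their copies would close a 4-cycle.\<close>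

lemma acyclic_matching_imp_independent:
  assumes M: "acyclic_matching G M" and card: "card M = K * t"
  shows "\<exists>E\<subseteq>V. (\<forall>e\<in>E. \<forall>e'\<in>E. \<not> cf e e') \<and> card E = K"
proof -
  let ?H = "induced_subgraph G (\<Union>M)"
  have MG: "M \<subseteq> snd G" and disj: "\<And>m m'. m \<in> M \<Longrightarrow> m' \<in> M \<Longrightarrow> m \<noteq> m' \<Longrightarrow> m \<inter> m' = {}"
    and acyc: "\<And>vs. \<not> cycle_in ?H vs"
    using M unfolding acyclic_matching_def matching_def acyclic_graph_def by blast+
  have "\<forall>m\<in>M. \<exists>u w. m = {u, w} \<and> u \<in> W \<and> w \<in> W \<and> sd u \<and> \<not> sd w \<and>
      (el u = el w \<and> cp u = cp w \<or> cf (el u) (el w))"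
    using MG by (fastforce simp: G)
  then obtain u w where uw: "\<And>m. m \<in> M \<Longrightarrow> m = {u m, w m} \<and> u m \<in> W \<and> w m \<in> W \<and> sd (u m) \<and>
      \<not> sd (w m) \<and> (el (u m) = el (w m) \<and> cp (u m) = cp (w m) \<or> cf (el (u m)) (el (w m)))"
    by metis
  have uU: "u m \<in> \<Union>M" "w m \<in> \<Union>M" if "m \<in> M" for m
    using uw[OF that] that by blast+
  have edgeH: "{u m, w m'} \<in> snd ?H" "{w m', u m} \<in> snd ?H"
    if "m \<in> M" "m' \<in> M" "m = m' \<or> cf (el (u m)) (el (w m'))" for m m'
  proof -
    have "{u m, w m'} \<in> snd G" using that uw[of m] uw[of m'] unfolding G by auto
    then show "{u m, w m'} \<in> snd ?H" "{w m', u m} \<in> snd ?H"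
      using uU that by (auto simp: induced_subgraph_def insert_commute)
  qed
  have neq: "u m \<noteq> u m' \<and> w m \<noteq> w m'" if "m \<in> M" "m' \<in> M" "m \<noteq> m'" for m m'
    using disj[OF that] uw[OF that(1)] uw[OF that(2)] by blast
  have neq': "u m \<noteq> w m'" if "m \<in> M" "m' \<in> M" for m m'
    using uw that by metis
  define Md where "Md = {m \<in> M. el (u m) = el (w m) \<and> cp (u m) = cp (w m)}"
  define Mr where "Mr r = {m \<in> M. \<alpha> r (el (u m)) < \<beta> r (el (w m))}" for r
  have finM: "finite M"
  proof (rule finite_subset)
    show "M \<subseteq> Pow W" using MG by (auto simp: G)
  qed (simp add: finite_W)
  \<comment> \<open>Order three edges by the \<alpha>-value at their \<open>u\<close>-end. Then
    \<open>u m1\<close> and \<open>u m2\<close> have \<alpha>-values below the \<beta>-values of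
    both \<open>w m2\<close> and \<open>w m3\<close>, so these four vertices form a 4-cycle.\<close>
  have "card (Mr r) \<le> 2" if r: "r \<in> R" for r
  proof (rule ccontr)
    assume "\<not> card (Mr r) \<le> 2"
    then have "3 \<le> card (Mr r)" by simp
    then obtain T where T: "T \<subseteq> Mr r" "card T = 3" by (metis obtain_subset_with_card_n)
    then obtain m1 m2 m3 where m: "m1 \<in> Mr r" "m2 \<in> Mr r" "m3 \<in> Mr r"
        "m1 \<noteq> m2" "m2 \<noteq> m3" "m1 \<noteq> m3"
      by (auto simp: card_3_iff)
    let ?a = "\<lambda>m. \<alpha> r (el (u m))"
    have no: False if m: "m1 \<in> Mr r" "m2 \<in> Mr r" "m3 \<in> Mr r" "m1 \<noteq> m2" "m2 \<noteq> m3" "m1 \<noteq> m3"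
      and le: "?a m1 \<le> ?a m2" "?a m2 \<le> ?a m3" for m1 m2 m3
    proof -
      have M3: "m1 \<in> M" "m2 \<in> M" "m3 \<in> M" and
        lt: "?a m2 < \<beta> r (el (w m2))" "?a m3 < \<beta> r (el (w m3))" using m by (auto simp: Mr_def)
      have cfI: "cf (el (u m)) (el (w m'))" if "m \<in> M" "m' \<in> M" "?a m < \<beta> r (el (w m'))" for m m'
        using that r uw[of m] uw[of m'] cf_iff vertex_range by blast
      have "cycle_in ?H [u m1, w m2, u m2, w m3]"
        using M3 lt le neq neq' m
        by (intro cycle_in_4I edgeH disjI2 cfI) (auto simp: neq' neq'[symmetric])
      then show False using acyc by blast
    qed
    show False
      using no[of m1 m2 m3] no[of m1 m3 m2] no[of m2 m1 m3] no[of m2 m3 m1] no[of m3 m1 m2] no[of m3 m2 m1] m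
      by (metis linorder_le_cases)
  qed
  then have cU: "card (\<Union>r\<in>R. Mr r) \<le> card R * 2"
    using card_UN_le[OF finR, of Mr] sum_bounded_above[of R "\<lambda>r. card (Mr r)" 2] by auto
  have "M \<subseteq> Md \<union> (\<Union>r\<in>R. Mr r)"
  proof
    fix m assume m: "m \<in> M"
    then show "m \<in> Md \<union> (\<Union>r\<in>R. Mr r)"
      using uw[OF m] cf_iff[of "el (u m)" "el (w m)"] vertex_range by (auto simp: Md_def Mr_def)
  qed
  note M_sub = this
  have cM: "card M \<le> card Md + card R * 2"
  proof -
    have fin: "finite (Md \<union> (\<Union>r\<in>R. Mr r))"
      using finM finR by (auto simp: Md_def Mr_def)
    have "card M \<le> card (Md \<union> (\<Union>r\<in>R. Mr r))"
      by (rule card_mono[OF fin M_sub])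
    also have "\<dots> \<le> card Md + card (\<Union>r\<in>R. Mr r)" by (rule card_Un_le)
    finally show ?thesis using cU by linarith
  qed
  define E where "E = (\<lambda>m. el (u m)) ` Md"
  have MdM: "m \<in> M" "el (u m) = el (w m)" "cp (u m) = cp (w m)" if "m \<in> Md" for m
    using that by (auto simp: Md_def)
  have EV: "E \<subseteq> V" using MdM uw vertex_range by (auto simp: E_def)
  have "card Md \<le> card (E \<times> {..<t})"
  proof (rule card_inj_on_le[where f = "\<lambda>m. (el (u m), cp (u m))"])
    show "inj_on (\<lambda>m. (el (u m), cp (u m))) Md"
    proof (rule inj_onI)
      fix m m' assume m: "m \<in> Md" "m' \<in> Md" "(el (u m), cp (u m)) = (el (u m'), cp (u m'))"
      then have "u m = u m'" using uw[of m] uw[of m'] MdM by (intro vertex_eqI) auto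
      then show "m = m'" using neq MdM m by blast
    qed
    show "(\<lambda>m. (el (u m), cp (u m))) ` Md \<subseteq> E \<times> {..<t}"
      using MdM uw vertex_range by (auto simp: E_def)
    show "finite (E \<times> {..<t})" using finite_subset[OF EV finV] by simp
  qed
  then have "card Md \<le> card E * t" by (simp add: card_cartesian_product)
  then have "K * t < (card E + 1) * t" using cM card R_less by (simp add: algebra_simps)
  then have "K \<le> card E" by (metis Suc_eq_plus1 less_Suc_eq_le mult_less_cancel2)
  then obtain E' where E': "E' \<subseteq> E" "card E' = K" by (metis obtain_subset_with_card_n)
  have "\<not> cf e e'" if ee: "e \<in> E" "e' \<in> E" for e e'
  proof
    assume cf: "cf e e'"
    obtain m m' where m: "m \<in> Md" "e = el (u m)" "m' \<in> Md" "e' = el (u m')"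
      using ee by (auto simp: E_def)
    have "m \<noteq> m'" using cf cf_irrefl EV ee m by blast
    \<comment> \<open>Both ends of an edge in \<open>Md\<close> carry the same element, so the
      symmetric conflict supplies the two edges between the copies.\<close>
    have "cycle_in ?H [u m, w m, u m', w m']"
      using m MdM[of m] MdM[of m'] cf cf_sym[OF cf] neq[of m m'] neq' \<open>m \<noteq> m'\<close>
      by (intro cycle_in_4I edgeH) (auto simp: neq'[symmetric])
    then show False using acyc by blast
  qed
  then show ?thesis using E' EV by (intro exI[of _ E']) blast
qed

lemma acyclic_matching_iff_independent:
  "(\<exists>M. acyclic_matching G M \<and> card M = K * t) \<longleftrightarrow>
    (\<exists>E\<subseteq>V. (\<forall>e\<in>E. \<forall>e'\<in>E. \<not> cf e e') \<and> card E = K)"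
  using acyclic_matching_imp_independent independent_imp_acyclic_matching by blast

end

section \<open>Weighted satisfiability as an independent set problem\<close>

text \<open>An assignment \<open>{x\<^sub>1 < \<dots> < x\<^sub>k}\<close> is described by the values \<open>s p = x\<^sub>p + 1\<close>, with the sentinels
  \<open>s 0 = 0\<close> and \<open>s (k + 1) = N + 1\<close>, and a pin \<open>(p, v)\<close> asserts \<open>s p = v\<close>.\<close>

type_synonym pin = "nat \<times> nat"

definition conflict :: "pin list \<Rightarrow> pin list \<Rightarrow> bool" where
  "conflict e e' \<longleftrightarrow> (\<exists>(p, v)\<in>set e. \<exists>(p', v')\<in>set e'. p = p' \<and> v \<noteq> v')"

text \<open>Two consecutive pins determine the truth value of every variable between them.\<close>

definition falsified :: "pin list \<Rightarrow> literal \<Rightarrow> bool" where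
  "falsified e l \<longleftrightarrow> (\<exists>(p, v)\<in>set e. \<exists>(p', v')\<in>set e. p' = Suc p \<and>
    v \<le> Suc (snd l) \<and> Suc (snd l) < v' \<and> (fst l \<longleftrightarrow> v \<noteq> Suc (snd l)))"

text \<open>Inner values are restricted to shifted variables that occur in \<open>\<phi>\<close>;
  this is what makes the selected set a subset of \<open>cnf_vars \<phi>\<close>.\<close>

definition pin_ok :: "cnf \<Rightarrow> nat \<Rightarrow> nat \<Rightarrow> pin \<Rightarrow> bool" where
  "pin_ok \<phi> k N pin \<longleftrightarrow> (if fst pin = 0 then snd pin = 0 else if fst pin = Suc k then snd pin = Suc N
    else \<exists>C\<in>set \<phi>. \<exists>l\<in>set C. snd pin = Suc (snd l))"

text \<open>Order is imposed only on neighbouring positions. This suffices because in a full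
  conflict-free family every pair \<open>p\<close>, \<open>Suc p\<close> occurs together in some
  element.\<close>

definition valid :: "cnf \<Rightarrow> nat \<Rightarrow> nat \<Rightarrow> pin list \<Rightarrow> bool" where
  "valid \<phi> k N e \<longleftrightarrow> (\<forall>pin\<in>set e. pin_ok \<phi> k N pin) \<and> \<not> conflict e e \<and>
    (\<forall>(p, v)\<in>set e. \<forall>(p', v')\<in>set e. p' = Suc p \<longrightarrow> v < v') \<and>
    (\<forall>C\<in>set \<phi>. \<exists>l\<in>set C. \<not> falsified e l)"

definition elements :: "cnf \<Rightarrow> nat \<Rightarrow> nat \<Rightarrow> nat \<Rightarrow> pin list set" where
  "elements \<phi> k N D = {e. set e \<subseteq> {..<k + 2} \<times> {..<N + 2} \<and> length e = D \<and> valid \<phi> k N e}"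

lemma finite_elements: "finite (elements \<phi> k N D)"
  unfolding elements_def
  by (rule finite_subset[OF _ finite_lists_length_eq[of "{..<k + 2} \<times> {..<N + 2}" D]]) auto

lemma conflict_sym: "conflict e e' \<Longrightarrow> conflict e' e"
  unfolding conflict_def by fastforce

lemma strict_mono_upto:
  fixes s :: "nat \<Rightarrow> nat"
  assumes "\<And>p. p < n \<Longrightarrow> s p < s (Suc p)" "p < q" "q \<le> n" shows "s p < s q"
  using assms(2,3)
proof (induction q)
  case (Suc q)
  then show ?case using assms(1)[of q] by (cases "p = q") auto
qed simp

text \<open>A discrete intermediate value argument. It places each variable between two consecutive
  values of \<open>s\<close>.\<close>

lemma exists_gap:
  fixes s :: "nat \<Rightarrow> nat"
  assumes "s 0 \<le> y" "y < s n" shows "\<exists>p<n. s p \<le> y \<and> y < s (Suc p)"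
  using assms
proof (induction n)
  case (Suc n)
  then show ?case by (cases "y < s n") (auto intro: less_SucI)
qed simp

text \<open>Conflict-free elements with the same list of positions are equal, so
  \<open>map fst\<close> is injective on \<open>E\<close>, and by counting it reaches every list of
  \<open>2 * d\<close> positions. Hence \<open>E\<close> describes one function \<open>s\<close>,
  and any \<open>2 * d\<close> positions occur jointly in some valid element: whatever validity says
  about at most \<open>2 * d\<close> positions holds for \<open>s\<close>.\<close>

lemma independent_elements_imp_satisfiable:
  assumes d: "is_d_cnf d \<phi>" "1 \<le> d" and N: "\<And>x. x \<in> cnf_vars \<phi> \<Longrightarrow> x < N"
    and E: "E \<subseteq> elements \<phi> k N (2 * d)" "\<forall>e\<in>E. \<forall>e'\<in>E. \<not> conflict e e'"
      "card E = (k + 2) ^ (2 * d)"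
  shows "\<exists>S\<subseteq>cnf_vars \<phi>. card S = k \<and> satisfies S \<phi>"
proof -
  define J where "J = {ps. set ps \<subseteq> {..<k + 2} \<and> length ps = 2 * d}"
  have uniq: "v = v'" if "e \<in> E" "e' \<in> E" "(p, v) \<in> set e" "(p, v') \<in> set e'" for e e' p v v'
    using E(2) that unfolding conflict_def by blast
  have inj: "inj_on (map fst) E"
  proof (rule inj_onI)
    fix e e' assume e: "e \<in> E" "e' \<in> E" "map fst e = map fst e'"
    then have len: "length e = length e'" by (metis length_map)
    show "e = e'"
    proof (rule nth_equalityI[OF len])
      fix i assume i: "i < length e"
      have f: "fst (e ! i) = fst (e' ! i)" using e(3) i len by (metis nth_map)
      have "(fst (e ! i), snd (e ! i)) \<in> set e" using i by simp
      moreover have "(fst (e ! i), snd (e' ! i)) \<in> set e'" using i len by (simp add: f)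
      ultimately have "snd (e ! i) = snd (e' ! i)" by (rule uniq[OF e(1,2)])
      with f show "e ! i = e' ! i" by (simp add: prod_eq_iff)
    qed
  qed
  have "map fst ` E = J"
  proof (rule card_subset_eq)
    show "finite J" unfolding J_def by (rule finite_lists_length_eq) simp
    show "map fst ` E \<subseteq> J" using E(1) by (fastforce simp: J_def elements_def)
    show "card (map fst ` E) = card J"
      using card_image[OF inj] E(3) card_lists_length_eq[of "{..<k + 2}" "2 * d"] by (simp add: J_def)
  qed
  define s where "s p = (SOME v. \<exists>e\<in>E. (p, v) \<in> set e)" for p
  have s: "s p = v" if "e \<in> E" "(p, v) \<in> set e" for e p v
  proof -
    have "\<exists>e\<in>E. (p, s p) \<in> set e" unfolding s_def by (rule someI[of _ v]) (use that in blast)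
    then show ?thesis using uniq that by blast
  qed
  have pins: "\<exists>e\<in>E. valid \<phi> k N e \<and> (\<forall>p\<in>set ps. (p, s p) \<in> set e)"
    if ps: "set ps \<subseteq> {..<k + 2}" "length ps \<le> 2 * d" for ps
  proof -
    \<comment> \<open>Position 0 always exists, so it can fill up shorter lists to the fixed
      length.\<close>
    have "ps @ replicate (2 * d - length ps) 0 \<in> J" using ps by (auto simp: J_def)
    then obtain e where e: "e \<in> E" "map fst e = ps @ replicate (2 * d - length ps) 0"
      using \<open>map fst ` E = J\<close> by (metis imageE)
    have "(p, s p) \<in> set e" if "p \<in> set ps" for p
    proof -
      have "p \<in> fst ` set e" using that e(2) by (metis Un_iff list.set_map set_append)
      then obtain v where "(p, v) \<in> set e" by force
      then show ?thesis using s e(1) by metis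
    qed
    then show ?thesis using e(1) E(1) by (auto simp: elements_def)
  qed
  have ok: "pin_ok \<phi> k N (p, s p)" if "p < k + 2" for p
    using pins[of "[p]"] that d(2) unfolding valid_def by force
  have s0: "s 0 = 0" using ok[of 0] by (simp add: pin_ok_def)
  have sk: "s (Suc k) = Suc N" using ok[of "Suc k"] by (simp add: pin_ok_def)
  have svar: "\<exists>x\<in>cnf_vars \<phi>. s p = Suc x" if "0 < p" "p \<le> k" for p
    using ok[of p] that unfolding pin_ok_def cnf_vars_def by fastforce
  have "s p < s (Suc p)" if p: "p < Suc k" for p
  proof -
    obtain e where "valid \<phi> k N e" "(p, s p) \<in> set e" "(Suc p, s (Suc p)) \<in> set e"
      using pins[of "[p, Suc p]"] p d(2) by auto
    then show ?thesis unfolding valid_def by blast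
  qed
  then have mono: "s p < s q" if "p < q" "q \<le> Suc k" for p q
    using strict_mono_upto[of "Suc k" s p q] that by blast
  have mono_le: "q \<le> p" if "s q \<le> s p" "p \<le> Suc k" "q \<le> Suc k" for p q
    using mono[of p q] that by (metis leD not_le_imp_less)
  define S where "S = (\<lambda>p. s p - 1) ` {1..k}"
  have Siff: "x \<in> S \<longleftrightarrow> (\<exists>p\<in>{1..k}. s p = Suc x)" for x
  proof -
    have "x = s p - 1 \<longleftrightarrow> s p = Suc x" if "p \<in> {1..k}" for p using svar[of p] that by auto
    then show ?thesis unfolding S_def image_iff by (rule bex_cong[OF refl])
  qed
  have "S \<subseteq> cnf_vars \<phi>"
  proof
    fix x assume "x \<in> S"
    then obtain p where "p \<in> {1..k}" "s p = Suc x" using Siff by blast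
    then show "x \<in> cnf_vars \<phi>" using svar[of p] by auto
  qed
  moreover have "card S = k"
  proof -
    have "inj_on (\<lambda>p. s p - 1) {1..k}"
    proof (rule inj_onI)
      fix p q assume pq: "p \<in> {1..k}" "q \<in> {1..k}" "s p - 1 = s q - 1"
      then have "s p = s q" using svar[of p] svar[of q] by auto
      then show "p = q" using mono_le[of p q] mono_le[of q p] pq by auto
    qed
    then show ?thesis unfolding S_def by (simp add: card_image)
  qed
  moreover have "satisfies S \<phi>"
    unfolding satisfies_def
  proof (rule ballI, rule ccontr)
    fix C assume C: "C \<in> set \<phi>" "\<not> (\<exists>(b, v)\<in>set C. (v \<in> S) = b)"
    have "\<exists>p<Suc k. s p \<le> Suc (snd l) \<and> Suc (snd l) < s (Suc p)" if "l \<in> set C" for l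
    proof -
      have "snd l < N" using that C(1) N[of "snd l"] by (auto simp: cnf_vars_def)
      then show ?thesis using exists_gap[of s "Suc (snd l)" "Suc k"] s0 sk by simp
    qed
    then obtain h where h: "\<And>l. l \<in> set C \<Longrightarrow> h l < Suc k \<and> s (h l) \<le> Suc (snd l) \<and> Suc (snd l) < s (Suc (h l))"
      by metis
    \<comment> \<open>The gaps of all literals of \<open>C\<close> fit into one list of positions,
      so a single element would falsify the entire clause, contradicting its validity.\<close>
    let ?ps = "concat (map (\<lambda>l. [h l, Suc (h l)]) C)"
    have "length ?ps = 2 * length C" by (induction C) auto
    then have "length ?ps \<le> 2 * d" using d(1) C(1) by (simp add: is_d_cnf_def)
    moreover have "set ?ps \<subseteq> {..<k + 2}" using h by fastforce
    ultimately obtain e where e: "valid \<phi> k N e" "\<And>p. p \<in> set ?ps \<Longrightarrow> (p, s p) \<in> set e"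
      using pins[of ?ps] by blast
    have "falsified e l" if l: "l \<in> set C" for l
    proof -
      have pin: "(h l, s (h l)) \<in> set e" "(Suc (h l), s (Suc (h l))) \<in> set e"
        using l by (intro e(2); force)+
      \<comment> \<open>By monotonicity the value \<open>Suc (snd l)\<close> can be taken only at
        the lower end of the gap.\<close>
      have "snd l \<in> S \<longleftrightarrow> s (h l) = Suc (snd l)"
      proof
        assume "snd l \<in> S"
        then obtain q where q: "q \<in> {1..k}" "s q = Suc (snd l)" using Siff by blast
        then have "h l \<le> q" using h[OF l] mono_le[of "h l" q] by simp
        moreover have "\<not> Suc (h l) \<le> q" using h[OF l] q mono[of "Suc (h l)" q]
          by (cases "Suc (h l) = q") auto
        ultimately show "s (h l) = Suc (snd l)" using q by (simp add: not_less_eq_eq)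
      next
        assume hl: "s (h l) = Suc (snd l)"
        then have "h l \<noteq> 0" using s0 by (metis Zero_not_Suc)
        then show "snd l \<in> S" using Siff hl h[OF l] by (metis atLeastAtMost_iff less_Suc_eq_le
              less_one not_le_imp_less)
      qed
      then have "fst l \<longleftrightarrow> s (h l) \<noteq> Suc (snd l)" using C(2) l by force
      then show ?thesis unfolding falsified_def using pin h[OF l] by blast
    qed
    then show False using e(1) C(1) unfolding valid_def by blast
  qed
  ultimately show ?thesis by blast
qed

text \<open>All elements are restrictions of the one function \<open>s\<close> that enumerates
  \<open>S\<close>, so they agree wherever they overlap. They are valid because a literal falsified
  by values of \<open>s\<close> is false under \<open>S\<close>.\<close>

lemma satisfiable_imp_independent_elements:
  assumes N: "\<And>x. x \<in> cnf_vars \<phi> \<Longrightarrow> x < N"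
    and S: "S \<subseteq> cnf_vars \<phi>" "card S = k" "satisfies S \<phi>"
  shows "\<exists>E\<subseteq>elements \<phi> k N D. (\<forall>e\<in>E. \<forall>e'\<in>E. \<not> conflict e e') \<and> card E = (k + 2) ^ D"
proof -
  have fin: "finite S" using S(1) by (rule finite_subset) (simp add: cnf_vars_def)
  define xs where "xs = sorted_list_of_set S"
  have xs: "set xs = S" "length xs = k" "sorted_wrt (<) xs"
    using fin S(2) by (auto simp: xs_def)
  define s where "s p = (if p = 0 then 0 else if p \<le> k then Suc (xs ! (p - 1)) else Suc N)" for p
  have inS: "xs ! (p - 1) \<in> S" if "0 < p" "p \<le> k" for p
    using nth_mem[of "p - 1" xs] xs(1,2) that by simp
  have "s p < s (Suc p)" if "p < Suc k" for p
  proof -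
    consider "p = 0" | "p = k" "0 < p" | "0 < p" "p < k" using \<open>p < Suc k\<close> by linarith
    then show ?thesis
    proof cases
      case 2
      then show ?thesis using inS[of p] N S(1) by (auto simp: s_def)
    next
      case 3
      then have "xs ! (p - 1) < xs ! p"
        using sorted_wrt_nth_less[OF xs(3), of "p - 1" p] xs(2) by auto
      then show ?thesis using 3 by (simp add: s_def)
    qed (simp add: s_def)
  qed
  then have mono: "s p < s q" if "p < q" "q \<le> Suc k" for p q
    using strict_mono_upto[of "Suc k" s p q] that by blast
  have Siff: "x \<in> S \<longleftrightarrow> (\<exists>p. 0 < p \<and> p \<le> k \<and> s p = Suc x)" for x
  proof
    assume "x \<in> S"
    then obtain i where "i < k" "xs ! i = x" using xs by (metis in_set_conv_nth)
    then show "\<exists>p. 0 < p \<and> p \<le> k \<and> s p = Suc x" by (intro exI[of _ "Suc i"]) (simp add: s_def)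
  next
    assume "\<exists>p. 0 < p \<and> p \<le> k \<and> s p = Suc x"
    then show "x \<in> S" using inS by (auto simp: s_def)
  qed
  have le: "s p \<le> Suc N" if "p \<le> Suc k" for p
    using mono[of p "Suc k"] that by (cases "p = Suc k") (auto simp: s_def)
  let ?e = "map (\<lambda>p. (p, s p))"
  let ?J = "{ps. set ps \<subseteq> {..<k + 2} \<and> length ps = D}"
  have "inj_on ?e ?J"
    by (rule inj_on_inverseI[where g = "map fst"]) (simp add: comp_def)
  then have "card (?e ` ?J) = (k + 2) ^ D"
    using card_lists_length_eq[of "{..<k + 2}" D] by (simp add: card_image)
  moreover have "\<not> conflict (?e ps) (?e qs)" for ps qs
    by (auto simp: conflict_def)
  moreover have "?e ps \<in> elements \<phi> k N D" if ps: "ps \<in> ?J" for ps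
  proof -
    have bound: "p \<le> Suc k" if "p \<in> set ps" for p using ps that by auto
    have "pin_ok \<phi> k N (p, s p)" if p: "p \<in> set ps" for p
    proof -
      have "\<exists>C\<in>set \<phi>. \<exists>l\<in>set C. s p = Suc (snd l)" if "0 < p" "p \<noteq> Suc k"
      proof -
        have "0 < p" "p \<le> k" using that bound[OF p] by auto
        moreover from this have "xs ! (p - 1) \<in> cnf_vars \<phi>" using inS S(1) by blast
        ultimately show ?thesis by (force simp: s_def cnf_vars_def)
      qed
      then show ?thesis by (auto simp: pin_ok_def s_def)
    qed
    moreover have "\<exists>l\<in>set C. \<not> falsified (?e ps) l" if C: "C \<in> set \<phi>" for C
    proof -
      obtain b x where l: "(b, x) \<in> set C" "x \<in> S \<longleftrightarrow> b"
        using S(3) C unfolding satisfies_def by fastforce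
      have "\<not> falsified (?e ps) (b, x)"
      proof
        assume "falsified (?e ps) (b, x)"
        then obtain p where p: "Suc p \<in> set ps" "s p \<le> Suc x" "Suc x < s (Suc p)" "b \<longleftrightarrow> s p \<noteq> Suc x"
          unfolding falsified_def by auto
        have pk: "p \<le> k" using bound[OF p(1)] by simp
        show False
        \<comment> \<open>If \<open>b\<close> holds, \<open>x\<close> lies in \<open>S\<close>, and
          its position would be strictly between \<open>p\<close> and \<open>Suc p\<close>.
          Otherwise \<open>s p = Suc x\<close> puts \<open>x\<close> into \<open>S\<close>; here
          \<open>p\<close> is not 0 since \<open>s 0 = 0\<close>.\<close>
        proof (cases b)
          case True
          then obtain q where q: "0 < q" "q \<le> k" "s q = Suc x" using l(2) Siff by blast
          have "s p < s q" "s q < s (Suc p)" using p q True by auto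
          then have "\<not> q \<le> p" "\<not> Suc p \<le> q"
            using mono[of q p] mono[of "Suc p" q] q pk by (auto simp: le_less)
          then show False by simp
        next
          case False
          then have "s p = Suc x" using p(4) by simp
          moreover from this have "0 < p" by (cases "p = 0") (auto simp: s_def)
          ultimately show False using Siff[of x] pk l(2) False by blast
        qed
      qed
      then show ?thesis using l(1) by blast
    qed
    moreover have "set (?e ps) \<subseteq> {..<k + 2} \<times> {..<N + 2}"
      using bound le by (fastforce simp: less_Suc_eq_le)
    ultimately show ?thesis
      using ps bound mono by (auto simp: elements_def valid_def conflict_def)
  qed
  ultimately show ?thesis by (intro exI[of _ "?e ` ?J"]) auto
qed

definition pin_value :: "int \<Rightarrow> pin list \<Rightarrow> nat \<Rightarrow> int" where
  "pin_value z e p = (case map_of e p of None \<Rightarrow> z | Some v \<Rightarrow> int v)"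

lemma map_of_elements:
  assumes "\<not> conflict e e" shows "map_of e p = Some v \<longleftrightarrow> (p, v) \<in> set e"
proof
  assume "(p, v) \<in> set e"
  then obtain w where "map_of e p = Some w" by (metis map_of_SomeD weak_map_of_SomeI)
  then show "map_of e p = Some v" using assms \<open>(p, v) \<in> set e\<close>
    unfolding conflict_def by (metis (mono_tags, lifting) case_prodI map_of_SomeD)
qed (rule map_of_SomeD)

text \<open>The defaults for undefined pins make the comparisons below false.\<close>

definition pin_source :: "nat \<Rightarrow> nat \<times> bool \<Rightarrow> pin list \<Rightarrow> int" where
  "pin_source N r e = (if snd r then pin_value (int N + 2) e (fst r) else - pin_value (-1) e (fst r))"

definition pin_target :: "nat \<Rightarrow> nat \<times> bool \<Rightarrow> pin list \<Rightarrow> int" where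
  "pin_target N r e = (if snd r then pin_value (-1) e (fst r) else - pin_value (int N + 2) e (fst r))"

text \<open>At a fixed position, different values mean \<open>v < v'\<close> or
  \<open>v' < v\<close>. The Boolean in \<open>r\<close> chooses between the two, and negating both
  sides turns the second into a comparison of the same direction.\<close>

lemma conflict_iff_half_graphs:
  assumes e: "e \<in> elements \<phi> k N D" and e': "e' \<in> elements \<phi> k N D"
  shows "conflict e e' \<longleftrightarrow> (\<exists>r\<in>{..<k + 2} \<times> UNIV. pin_source N r e < pin_target N r e')"
proof -
  have "\<not> conflict e e" "\<not> conflict e' e'" using e e' by (auto simp: elements_def valid_def)
  note mo = this[THEN map_of_elements]
  have rng: "p < k + 2 \<and> v < N + 2" if "(p, v) \<in> set e \<or> (p, v) \<in> set e'" for p v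
    using that e e' by (auto simp: elements_def)
  have cmp: "pin_source N (p, b) e < pin_target N (p, b) e' \<longleftrightarrow>
    (\<exists>v v'. (p, v) \<in> set e \<and> (p, v') \<in> set e' \<and> (if b then v < v' else v' < v))" for p b
  proof (cases "map_of e p"; cases "map_of e' p")
    fix v v' assume m: "map_of e p = Some v" "map_of e' p = Some v'"
    then show ?thesis unfolding mo[symmetric] by (simp add: pin_source_def pin_target_def pin_value_def)
  next
    fix v assume m: "map_of e p = Some v" "map_of e' p = None"
    then have "v < N + 2" using rng mo by blast
    then show ?thesis using m unfolding mo[symmetric]
      by (simp add: pin_source_def pin_target_def pin_value_def)
  next
    fix v' assume m: "map_of e p = None" "map_of e' p = Some v'"
    then have "v' < N + 2" using rng mo by blast
    then show ?thesis using m unfolding mo[symmetric]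
      by (simp add: pin_source_def pin_target_def pin_value_def)
  qed (simp_all add: mo[symmetric] pin_source_def pin_target_def pin_value_def)
  have "conflict e e' \<longleftrightarrow> (\<exists>p<k + 2. \<exists>b v v'. (p, v) \<in> set e \<and> (p, v') \<in> set e' \<and>
      (if b then v < v' else v' < v))"
  proof
    assume "conflict e e'"
    then obtain p v v' where "(p, v) \<in> set e" "(p, v') \<in> set e'" "v \<noteq> v'"
      unfolding conflict_def by blast
    moreover from this have "if v < v' then v < v' else v' < v" by auto
    ultimately show "\<exists>p<k + 2. \<exists>b v v'. (p, v) \<in> set e \<and> (p, v') \<in> set e' \<and>
      (if b then v < v' else v' < v)" using rng by blast
  next
    assume "\<exists>p<k + 2. \<exists>b v v'. (p, v) \<in> set e \<and> (p, v') \<in> set e' \<and>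
      (if b then v < v' else v' < v)"
    then obtain p v v' where "(p, v) \<in> set e" "(p, v') \<in> set e'" "v \<noteq> v'"
      by (metis less_irrefl)
    then show "conflict e e'" unfolding conflict_def by blast
  qed
  moreover have "(\<exists>r\<in>{..<k + 2} \<times> UNIV. Q r) \<longleftrightarrow> (\<exists>p<k + 2. \<exists>b. Q (p, b))" for Q :: "nat \<times> bool \<Rightarrow> bool"
    by (simp add: Bex_def)
  ultimately show ?thesis by (simp only: cmp)
qed

section \<open>The reduction as a polynomial-time function\<close>

subsection \<open>Bounded quantifiers, products and ranges\<close>

text \<open>The predicate receives a context \<open>c\<close> since programs have no closures;
  nested quantifiers pass outer variables through it.\<close>

definition data_ex :: "(data \<Rightarrow> data \<Rightarrow> data) \<Rightarrow> data \<Rightarrow> data \<Rightarrow> data" where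
  "data_ex P c l = data_fold (\<lambda>e a. data_if (P c e) (data_of_bool True) a) Leaf l"

definition data_all :: "(data \<Rightarrow> data \<Rightarrow> data) \<Rightarrow> data \<Rightarrow> data \<Rightarrow> data" where
  "data_all P c l = data_not (data_ex (\<lambda>c e. data_not (P c e)) c l)"

lemma ptime_ex:
  assumes "ptime2 P" "ptime f" "ptime g" shows "ptime (\<lambda>x. data_ex P (f x) (g x))"
  unfolding data_ex_def
  by (rule ptime_fold[where h = "\<lambda>c e a. data_if (P c e) (data_of_bool True) a"])
    (intro ptime_arith ptime2_app[OF assms(1)] additive_if additive_acc additive_ptime assms(2,3))+

lemma ptime_all:
  assumes "ptime2 P" "ptime f" "ptime g" shows "ptime (\<lambda>x. data_all P (f x) (g x))"
  unfolding data_all_def using assms unfolding ptime2_def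
  by (intro ptime_not ptime_ex) (auto simp: ptime2_def intro: ptime_not)

lemma data_ex_of_list:
  assumes "\<And>x. x \<in> set xs \<Longrightarrow> P c (f x) = data_of_bool (Q x)"
  shows "data_ex P c (data_of_list f xs) = data_of_bool (\<exists>x\<in>set xs. Q x)"
proof -
  have "fold (\<lambda>x a. data_if (P c (f x)) (data_of_bool True) a) xs (data_of_bool b)
      = data_of_bool (b \<or> (\<exists>x\<in>set xs. Q x))" for b
    using assms
  proof (induction xs arbitrary: b)
    case (Cons x xs)
    show ?case using Cons.IH[of True] Cons.IH[of b] Cons.prems by auto
  qed simp
  from this[of False] show ?thesis
    by (simp add: data_ex_def data_fold_of_list) (simp add: data_of_bool_def)
qed

lemma data_all_of_list:
  assumes "\<And>x. x \<in> set xs \<Longrightarrow> P c (f x) = data_of_bool (Q x)"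
  shows "data_all P c (data_of_list f xs) = data_of_bool (\<forall>x\<in>set xs. Q x)"
  unfolding data_all_def
  by (subst data_ex_of_list[where Q = "\<lambda>x. \<not> Q x"]) (simp_all add: assms)

definition data_product :: "(data \<Rightarrow> data \<Rightarrow> data) \<Rightarrow> data \<Rightarrow> data \<Rightarrow> data \<Rightarrow> data" where
  "data_product h a l m = data_fold (\<lambda>x a. data_fold (\<lambda>y a. Node (h x y) a) a m) a l"

lemma ptime_product:
  assumes "ptime2 h" "ptime f" "ptime g" "ptime g'"
  shows "ptime (\<lambda>x. data_product h (f x) (g x) (g' x))"
  unfolding data_product_def
proof (rule ptime_fold[where h = "\<lambda>m x a. data_fold (\<lambda>y a. Node (h x y) a) a m"])
  show "ptime (\<lambda>z. data_fold (\<lambda>y a. Node (h (data_hd (data_tl z)) y) a) (data_tl (data_tl z)) (data_hd z))"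
    by (rule ptime_fold[where h = "\<lambda>x y a. Node (h x y) a"])
      (intro ptime_intros ptime2_app[OF assms(1)] additive_Node additive_acc)+
  show "additive (\<lambda>z a. data_fold (\<lambda>y a. Node (h (data_tl z) y) a) a (data_hd z))"
    by (rule additive_fold[where h = "\<lambda>x y a. Node (h x y) a"])
      (intro ptime_intros ptime2_app[OF assms(1)] additive_Node additive_acc)+
qed (use assms in auto)

text \<open>Folding prepends, so both factors appear reversed. For pins, elements and vertices only
  the set and distinctness matter; for the adjacency matrix the reversal is compensated
  later.\<close>

lemma data_product_of_list:
  assumes "\<And>x y. x \<in> set xs \<Longrightarrow> y \<in> set ys \<Longrightarrow> h (f x) (g y) = k (r x y)"
  shows "data_product h (data_of_list k zs) (data_of_list f xs) (data_of_list g ys) =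
    data_of_list k (map (\<lambda>(x, y). r x y) (List.product (rev xs) (rev ys)) @ zs)"
proof -
  have inner: "fold (\<lambda>y a. Node (h (f x) (g y)) a) ys (data_of_list k zs) =
      data_of_list k (map (r x) (rev ys) @ zs)" if x: "x \<in> set xs" for x zs
    using assms[OF x]
  proof (induction ys arbitrary: zs)
    case (Cons y ys)
    show ?case using Cons.IH[of "r x y # zs"] Cons.prems by simp
  qed simp
  have "fold (\<lambda>x a. fold (\<lambda>y a. Node (h (f x) (g y)) a) ys a) us (data_of_list k zs) =
      data_of_list k (map (\<lambda>(x, y). r x y) (List.product (rev us) (rev ys)) @ zs)"
    if "set us \<subseteq> set xs" for us zs
    using that
  proof (induction us arbitrary: zs)
    case (Cons x us)
    then have "fold (\<lambda>x a. fold (\<lambda>y a. Node (h (f x) (g y)) a) ys a) (x # us) (data_of_list k zs) =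
      data_of_list k (map (\<lambda>(x, y). r x y) (List.product (rev us) (rev ys)) @ map (r x) (rev ys) @ zs)"
      by (simp add: inner)
    also have "map (\<lambda>(x, y). r x y) (List.product (rev us) (rev ys)) @ map (r x) (rev ys) @ zs =
      map (\<lambda>(x, y). r x y) (List.product (rev (x # us)) (rev ys)) @ zs"
      by (simp add: product_concat_map comp_def)
    finally show ?case .
  qed simp
  from this[of xs] show ?thesis by (simp add: data_product_def data_fold_of_list)
qed

definition data_filter :: "(data \<Rightarrow> data \<Rightarrow> data) \<Rightarrow> data \<Rightarrow> data \<Rightarrow> data" where
  "data_filter P c l = data_fold (\<lambda>e a. data_if (P c e) (Node e a) a) Leaf l"

lemma ptime_filter:
  assumes "ptime2 P" "ptime f" "ptime g" shows "ptime (\<lambda>x. data_filter P (f x) (g x))"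
  unfolding data_filter_def
  by (rule ptime_fold[where h = "\<lambda>c e a. data_if (P c e) (Node e a) a"])
    (intro ptime_intros ptime2_app[OF assms(1)] additive_if additive_Node additive_acc assms(2,3))+

lemma data_filter_of_list:
  assumes "\<And>x. x \<in> set xs \<Longrightarrow> P c (f x) = data_of_bool (Q x)"
  shows "data_filter P c (data_of_list f xs) = data_of_list f (rev (filter Q xs))"
proof -
  have "fold (\<lambda>x a. data_if (P c (f x)) (Node (f x) a) a) xs (data_of_list f zs)
      = data_of_list f (rev (filter Q xs) @ zs)" for zs
    using assms
  proof (induction xs arbitrary: zs)
    case (Cons x xs)
    show ?case using Cons.IH[of zs] Cons.IH[of "x # zs"] Cons.prems by auto
  qed simp
  from this[of "[]"] show ?thesis by (simp add: data_filter_def data_fold_of_list)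
qed

text \<open>The length of the accumulator is the loop counter. The entries are produced from
  \<open>n - 1\<close> downwards and prepended, hence the list ascends.\<close>

definition data_range :: "data \<Rightarrow> data" where
  "data_range n = data_fold (\<lambda>_ a. Node (data_tl (data_drop n a)) a) Leaf n"

lemma data_size_drop_le: "data_size (data_drop a b) \<le> data_size a"
proof -
  have "data_size ((data_tl ^^ n) a) \<le> data_size a" for n
    by (induction n) (auto intro: data_size_tl_le order_trans)
  then show ?thesis by (simp add: data_drop_def data_fold_const)
qed

lemma ptime_range:
  assumes "ptime f" shows "ptime (\<lambda>x. data_range (f x))"
  unfolding data_range_def
proof (rule ptime_fold[where h = "\<lambda>n _ a. Node (data_tl (data_drop n a)) a"])
  show "additive (\<lambda>z a. Node (data_tl (data_drop (data_hd z) a)) a)"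
  proof (rule additiveI[where q = "\<lambda>z. 1 + data_size z"])
    fix z a
    have "data_size (data_tl (data_drop (data_hd z) a)) \<le> data_size z"
      by (meson data_size_tl_le data_size_drop_le data_size_hd_le order_trans)
    then show "data_size (Node (data_tl (data_drop (data_hd z) a)) a) \<le> data_size a + (1 + data_size z)"
      by simp
  qed (intro poly_bounded_intros)
qed (intro ptime_arith assms)+

lemma data_range_of_nat [simp]: "data_range (data_of_nat n) = data_of_list data_of_nat [0..<n]"
proof -
  have "((\<lambda>a. Node (data_tl (data_drop (data_of_nat n) a)) a) ^^ i) Leaf =
      data_of_list data_of_nat [n - i..<n]" if "i \<le> n" for i
    using that
  proof (induction i)
    case (Suc i)
    have "data_tl (data_of_nat (n - i)) = data_of_nat (n - Suc i)"
      using Suc.prems by (metis Suc_diff_Suc Suc_le_lessD data_of_nat_simps(2) data_tl.simps(2))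
    moreover have "[n - Suc i..<n] = (n - Suc i) # [n - i..<n]"
      using Suc.prems by (simp add: upt_conv_Cons Suc_diff_Suc)
    ultimately show ?case using Suc by simp
  qed simp
  from this[of n] show ?thesis by (simp add: data_range_def data_fold_const)
qed

lemmas ptime_lists = ptime_arith ptime_ex ptime_all ptime_product ptime_filter ptime_range

subsection \<open>Pins, elements and vertices\<close>

fun data_of_pin :: "pin \<Rightarrow> data" where
  "data_of_pin (p, v) = Node (data_of_nat p) (data_of_nat v)"

abbreviation data_of_element :: "pin list \<Rightarrow> data" where
  "data_of_element \<equiv> data_of_list data_of_pin"

fun data_of_literal :: "literal \<Rightarrow> data" where
  "data_of_literal (b, x) = Node (data_of_bool b) (data_of_nat x)"

abbreviation data_of_cnf :: "cnf \<Rightarrow> data" where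
  "data_of_cnf \<equiv> data_of_list (data_of_list data_of_literal)"

lemma data_hd_tl_pin [simp]:
  "data_hd (data_of_pin pin) = data_of_nat (fst pin)" "data_tl (data_of_pin pin) = data_of_nat (snd pin)"
  by (cases pin; simp)+

lemma data_hd_tl_literal [simp]:
  "data_hd (data_of_literal l) = data_of_bool (fst l)" "data_tl (data_of_literal l) = data_of_nat (snd l)"
  by (cases l; simp)+

definition data_conflict :: "data \<Rightarrow> data \<Rightarrow> data" where
  "data_conflict e e' = data_ex (\<lambda>e' pin. data_ex (\<lambda>pin pin'.
    data_and (data_eq (data_hd pin) (data_hd pin')) (data_not (data_eq (data_tl pin) (data_tl pin')))) pin e') e' e"

lemma ptime_conflict: "ptime f \<Longrightarrow> ptime g \<Longrightarrow> ptime (\<lambda>x. data_conflict (f x) (g x))"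
  unfolding data_conflict_def by (intro ptime_lists | simp only: ptime2_def)+

lemma data_conflict [simp]:
  "data_conflict (data_of_element e) (data_of_element e') = data_of_bool (conflict e e')"
proof -
  have "data_conflict (data_of_element e) (data_of_element e') = data_of_bool
      (\<exists>pin\<in>set e. \<exists>pin'\<in>set e'. fst pin = fst pin' \<and> snd pin \<noteq> snd pin')"
    unfolding data_conflict_def by (intro data_ex_of_list) simp
  also have "(\<exists>pin\<in>set e. \<exists>pin'\<in>set e'. fst pin = fst pin' \<and> snd pin \<noteq> snd pin') \<longleftrightarrow> conflict e e'"
    by (auto simp: conflict_def split_beta)
  finally show ?thesis .
qed

definition data_falsified :: "data \<Rightarrow> data \<Rightarrow> data" where
  "data_falsified e l = data_ex (\<lambda>el pin. data_ex (\<lambda>pl pin'.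
      data_and (data_eq (data_hd pin') (Node Leaf (data_hd (data_hd pl))))
      (data_and (data_le (data_tl (data_hd pl)) (Node Leaf (data_tl (data_tl pl))))
      (data_and (data_le (Node Leaf (Node Leaf (data_tl (data_tl pl)))) (data_tl pin'))
      (data_if (data_hd (data_tl pl))
        (data_not (data_eq (data_tl (data_hd pl)) (Node Leaf (data_tl (data_tl pl)))))
        (data_eq (data_tl (data_hd pl)) (Node Leaf (data_tl (data_tl pl))))))))
    (Node pin (data_tl el)) (data_hd el)) (Node e l) e"

lemma ptime_falsified: "ptime f \<Longrightarrow> ptime g \<Longrightarrow> ptime (\<lambda>x. data_falsified (f x) (g x))"
  unfolding data_falsified_def by (intro ptime_lists | simp only: ptime2_def)+

lemma data_falsified [simp]:
  "data_falsified (data_of_element e) (data_of_literal l) = data_of_bool (falsified e l)"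
proof -
  have "data_falsified (data_of_element e) (data_of_literal l) = data_of_bool
      (\<exists>pin\<in>set e. \<exists>pin'\<in>set e. fst pin' = Suc (fst pin) \<and> snd pin \<le> Suc (snd l) \<and>
        Suc (Suc (snd l)) \<le> snd pin' \<and> (fst l \<longleftrightarrow> snd pin \<noteq> Suc (snd l)))"
    unfolding data_falsified_def
    by (rule data_ex_of_list, simp only: data_hd.simps data_tl.simps, rule data_ex_of_list) simp
  also have "(\<exists>pin\<in>set e. \<exists>pin'\<in>set e. fst pin' = Suc (fst pin) \<and> snd pin \<le> Suc (snd l) \<and>
        Suc (Suc (snd l)) \<le> snd pin' \<and> (fst l \<longleftrightarrow> snd pin \<noteq> Suc (snd l))) \<longleftrightarrow> falsified e l"
    unfolding falsified_def Suc_le_eq by (simp only: case_prod_unfold)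
  finally show ?thesis .
qed

definition data_pin_ok :: "data \<Rightarrow> data \<Rightarrow> data" where
  "data_pin_ok c pin = data_if (data_eq (data_hd pin) Leaf) (data_eq (data_tl pin) Leaf)
    (data_if (data_eq (data_hd pin) (Node Leaf (data_hd (data_tl c))))
      (data_eq (data_tl pin) (Node Leaf (data_tl (data_tl c))))
      (data_ex (data_ex (\<lambda>v l. data_eq v (Node Leaf (data_tl l)))) (data_tl pin) (data_hd c)))"

lemma ptime_pin_ok: "ptime2 data_pin_ok"
  unfolding data_pin_ok_def[abs_def] by (intro ptime_lists | simp only: ptime2_def)+

lemma data_pin_ok [simp]:
  "data_pin_ok (Node (data_of_cnf \<phi>) (Node (data_of_nat k) (data_of_nat N))) (data_of_pin pin) =
    data_of_bool (pin_ok \<phi> k N pin)"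
proof -
  have "data_ex (data_ex (\<lambda>v l. data_eq v (Node Leaf (data_tl l)))) (data_of_nat v) (data_of_cnf \<phi>) =
      data_of_bool (\<exists>C\<in>set \<phi>. \<exists>l\<in>set C. v = Suc (snd l))" for v
    by (intro data_ex_of_list) simp
  then show ?thesis by (simp add: data_pin_ok_def pin_ok_def)
qed

definition data_valid :: "data \<Rightarrow> data \<Rightarrow> data" where
  "data_valid c e = data_and (data_all data_pin_ok c e) (data_and (data_not (data_conflict e e))
    (data_and (data_all (\<lambda>e pin. data_all (\<lambda>pin pin'.
        data_or (data_not (data_eq (data_hd pin') (Node Leaf (data_hd pin))))
          (data_le (Node Leaf (data_tl pin)) (data_tl pin'))) pin e) e e)
      (data_all (data_ex (\<lambda>e l. data_not (data_falsified e l))) e (data_hd c))))"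

lemma ptime_valid: "ptime2 data_valid"
  unfolding data_valid_def[abs_def]
  by (intro ptime_lists ptime_conflict ptime_falsified ptime_pin_ok | simp only: ptime2_def)+

lemma data_valid [simp]:
  "data_valid (Node (data_of_cnf \<phi>) (Node (data_of_nat k) (data_of_nat N))) (data_of_element e) =
    data_of_bool (valid \<phi> k N e)"
proof -
  have 1: "data_all data_pin_ok (Node (data_of_cnf \<phi>) (Node (data_of_nat k) (data_of_nat N)))
      (data_of_element e) = data_of_bool (\<forall>pin\<in>set e. pin_ok \<phi> k N pin)"
    by (intro data_all_of_list) simp
  have 2: "data_all (\<lambda>e pin. data_all (\<lambda>pin pin'.
        data_or (data_not (data_eq (data_hd pin') (Node Leaf (data_hd pin))))
          (data_le (Node Leaf (data_tl pin)) (data_tl pin'))) pin e) (data_of_element e) (data_of_element e) =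
      data_of_bool (\<forall>pin\<in>set e. \<forall>pin'\<in>set e. fst pin' \<noteq> Suc (fst pin) \<or> Suc (snd pin) \<le> snd pin')"
    by (intro data_all_of_list) simp
  have 3: "data_all (data_ex (\<lambda>e l. data_not (data_falsified e l))) (data_of_element e) (data_of_cnf \<phi>) =
      data_of_bool (\<forall>C\<in>set \<phi>. \<exists>l\<in>set C. \<not> falsified e l)"
    by (intro data_all_of_list data_ex_of_list) simp
  have "valid \<phi> k N e \<longleftrightarrow> (\<forall>pin\<in>set e. pin_ok \<phi> k N pin) \<and> \<not> conflict e e \<and>
      (\<forall>pin\<in>set e. \<forall>pin'\<in>set e. fst pin' \<noteq> Suc (fst pin) \<or> Suc (snd pin) \<le> snd pin') \<and>
      (\<forall>C\<in>set \<phi>. \<exists>l\<in>set C. \<not> falsified e l)"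
    unfolding valid_def by (simp only: case_prod_unfold Suc_le_eq imp_conv_disj)
  then show ?thesis unfolding data_valid_def data_hd.simps 1 2 3 by simp
qed

text \<open>\<open>data_eq\<close> compares only lengths, so pins are compared componentwise. All
  elements have the same constant length, which allows the recursion to be unfolded into a fixed
  program.\<close>

primrec data_eq_element :: "nat \<Rightarrow> data \<Rightarrow> data \<Rightarrow> data" where
  "data_eq_element 0 e e' = data_of_bool True"
| "data_eq_element (Suc n) e e' =
    data_and (data_and (data_eq (data_hd (data_hd e)) (data_hd (data_hd e')))
        (data_eq (data_tl (data_hd e)) (data_tl (data_hd e'))))
      (data_eq_element n (data_tl e) (data_tl e'))"

lemma ptime_eq_element: "ptime f \<Longrightarrow> ptime g \<Longrightarrow> ptime (\<lambda>x. data_eq_element n (f x) (g x))"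
proof (induction n arbitrary: f g)
  case (Suc n)
  show ?case unfolding data_eq_element.simps by (intro ptime_lists Suc)
qed (simp add: ptime_const)

lemma data_eq_element:
  "length e = n \<Longrightarrow> length e' = n \<Longrightarrow>
    data_eq_element n (data_of_element e) (data_of_element e') = data_of_bool (e = e')"
proof (induction n arbitrary: e e')
  case (Suc n)
  obtain a f b f' where [simp]: "e = a # f" "e' = b # f'" using Suc.prems by (auto simp: length_Suc_conv)
  show ?case using Suc by (simp add: prod_eq_iff)
qed simp

type_synonym vertex = "bool \<times> pin list \<times> nat"

fun data_of_vertex :: "vertex \<Rightarrow> data" where
  "data_of_vertex (b, e, s) = Node (data_of_bool b) (Node (data_of_element e) (data_of_nat s))"

fun adjacent :: "vertex \<Rightarrow> vertex \<Rightarrow> bool" where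
  "adjacent (b, e, s) (b', e', s') \<longleftrightarrow> b \<noteq> b' \<and> (e = e' \<and> s = s' \<or> conflict e e')"

definition data_adjacent :: "nat \<Rightarrow> data \<Rightarrow> data \<Rightarrow> data" where
  "data_adjacent D u w = data_and (data_if (data_hd u) (data_not (data_hd w)) (data_hd w))
    (data_or (data_and (data_eq_element D (data_hd (data_tl u)) (data_hd (data_tl w)))
        (data_eq (data_tl (data_tl u)) (data_tl (data_tl w))))
      (data_conflict (data_hd (data_tl u)) (data_hd (data_tl w))))"

lemma ptime_adjacent: "ptime2 (data_adjacent D)"
  unfolding data_adjacent_def[abs_def] ptime2_def
  by (intro ptime_lists ptime_conflict ptime_eq_element)

lemma data_adjacent:
  assumes "length (fst (snd u)) = D" "length (fst (snd w)) = D"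
  shows "data_adjacent D (data_of_vertex u) (data_of_vertex w) = data_of_bool (adjacent u w)"
proof (cases u; cases w)
  fix b e s b' e' s' assume [simp]: "u = (b, e, s)" "w = (b', e', s')"
  have "(if b then data_not (data_of_bool b') else data_of_bool b') = data_of_bool (b \<noteq> b')" by simp
  then show ?thesis using assms by (simp add: data_adjacent_def data_eq_element)
qed

subsection \<open>Parsing formulas\<close>

text \<open>The parser is an automaton whose state is a number (0: before a clause, 1: before a literal,
  2: before a sign, 3: inside a number, 4: accepting, 5: rejecting), together with the current
  sign and number, the current clause and the clauses read so far, both in reverse order.\<close>

definition parser_state :: "nat \<Rightarrow> data \<Rightarrow> data \<Rightarrow> data \<Rightarrow> data \<Rightarrow> data" where
  "parser_state i sg nm cl cls = Node (data_of_nat i) (Node (Node sg nm) (Node cl cls))"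

text \<open>State 4 has no continuation of its own: any further bit leads to state 5, so strings
  with trailing bits are rejected.\<close>

definition parser_step :: "data \<Rightarrow> data \<Rightarrow> data" where
  "parser_step b a = (let i = data_hd a; sg = data_hd (data_hd (data_tl a)); nm = data_tl (data_hd (data_tl a));
      cl = data_hd (data_tl (data_tl a)); cls = data_tl (data_tl (data_tl a))
    in data_if (data_eq i (data_of_nat 0))
        (data_if b (parser_state 1 Leaf Leaf Leaf cls) (parser_state 4 Leaf Leaf Leaf cls))
      (data_if (data_eq i (data_of_nat 1))
        (data_if b (parser_state 2 Leaf Leaf cl cls) (parser_state 0 Leaf Leaf Leaf (Node cl cls)))
      (data_if (data_eq i (data_of_nat 2))
        (parser_state 3 b Leaf cl cls)
      (data_if (data_eq i (data_of_nat 3))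
        (data_if b (parser_state 3 sg (Node Leaf nm) cl cls)
          (parser_state 1 Leaf Leaf (Node (Node sg nm) cl) cls))
        (parser_state 5 Leaf Leaf Leaf Leaf)))))"

definition data_parse :: "data \<Rightarrow> data" where
  "data_parse w = data_fold parser_step (parser_state 0 Leaf Leaf Leaf Leaf) w"

lemma ptime_parse:
  assumes "ptime f" shows "ptime (\<lambda>x. data_parse (f x))"
  unfolding data_parse_def
proof (rule ptime_fold[where h = "\<lambda>_. parser_step" and C = "\<lambda>_. Leaf"])
  show "ptime (\<lambda>z. parser_step (data_hd (data_tl z)) (data_tl (data_tl z)))"
    unfolding parser_step_def Let_def parser_state_def by (intro ptime_lists)
  show "additive (\<lambda>z. parser_step (data_tl z))"
  \<comment> \<open>Every branch uses each component of the state at most once, so nothing is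
    duplicated; 30 covers the newly created nodes.\<close>
  proof (rule additiveI[where q = "\<lambda>z. 30 + data_size z"])
    fix z a
    have "data_size (parser_step b a) \<le> data_size a + (30 + data_size b)" for b
      using data_size_hd_tl[of a] data_size_hd_tl[of "data_tl a"] data_size_hd_tl[of "data_tl (data_tl a)"]
        data_size_hd_tl[of "data_hd (data_tl a)"]
      by (simp add: parser_step_def Let_def data_if_def parser_state_def)
    from this[of "data_tl z"] data_size_tl_le[of z]
    show "data_size (parser_step (data_tl z) a) \<le> data_size a + (30 + data_size z)" by simp
  qed (intro poly_bounded_intros)
qed (intro ptime_intros assms)+

abbreviation parse :: "bool list \<Rightarrow> data \<Rightarrow> data" where
  "parse w a \<equiv> fold (\<lambda>b. parser_step (data_of_bool b)) w a"

abbreviation reverse_cnf :: "cnf \<Rightarrow> cnf" where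
  "reverse_cnf \<phi> \<equiv> rev (map rev \<phi>)"

lemma parser_step_simps:
  "parser_step (data_of_bool b) (parser_state 0 sg nm cl cls) =
    parser_state (if b then 1 else 4) Leaf Leaf Leaf cls"
  "parser_step (data_of_bool b) (parser_state 1 sg nm cl cls) =
    (if b then parser_state 2 Leaf Leaf cl cls else parser_state 0 Leaf Leaf Leaf (Node cl cls))"
  "parser_step (data_of_bool b) (parser_state 2 sg nm cl cls) = parser_state 3 (data_of_bool b) Leaf cl cls"
  "parser_step (data_of_bool b) (parser_state 3 sg nm cl cls) =
    (if b then parser_state 3 sg (Node Leaf nm) cl cls
      else parser_state 1 Leaf Leaf (Node (Node sg nm) cl) cls)"
  "4 \<le> data_length (data_hd a) \<Longrightarrow> parser_step (data_of_bool b) a = parser_state 5 Leaf Leaf Leaf Leaf"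
proof -
  assume "4 \<le> data_length (data_hd a)"
  then show "parser_step (data_of_bool b) a = parser_state 5 Leaf Leaf Leaf Leaf"
    by (simp add: parser_step_def Let_def del: data_length_eq_0)
qed (simp_all add: parser_step_def parser_state_def Let_def numeral_eq_Suc)

lemma parse_number:
  "parse (replicate n True) (parser_state 3 sg (data_of_nat m) cl cls) =
    parser_state 3 sg (data_of_nat (m + n)) cl cls"
proof (induction n arbitrary: m)
  case (Suc n)
  show ?case using Suc[of "Suc m"] by (simp add: parser_step_simps)
qed simp

lemma parse_literal:
  "parse (encode_literal l) (parser_state 2 Leaf Leaf cl cls) =
    parser_state 1 Leaf Leaf (Node (data_of_literal l) cl) cls"
  using parse_number[of "snd l" "data_of_bool (fst l)" 0 cl cls]
  by (cases l) (simp add: encode_literal_def encode_nat_def parser_step_simps del: One_nat_def)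

lemma parse_clause:
  "parse (encode_list encode_literal C) (parser_state 1 Leaf Leaf (data_of_list data_of_literal Z) cls) =
    parser_state 0 Leaf Leaf Leaf (Node (data_of_list data_of_literal (rev C @ Z)) cls)"
proof (induction C arbitrary: Z)
  case (Cons l C)
  show ?case using Cons[of "l # Z"]
    by (simp add: encode_list_def parser_step_simps parse_literal del: One_nat_def)
qed (simp add: encode_list_def parser_step_simps del: One_nat_def)

lemma parse_cnf:
  "parse (encode_cnf \<phi>) (parser_state 0 Leaf Leaf Leaf (data_of_cnf \<psi>)) =
    parser_state 4 Leaf Leaf Leaf (data_of_cnf (reverse_cnf \<phi> @ \<psi>))"
proof (induction \<phi> arbitrary: \<psi>)
  case (Cons C \<phi>)
  show ?case using Cons[of "rev C # \<psi>"] parse_clause[of C "[]"]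
    by (simp add: encode_cnf_def encode_list_def[of "encode_list encode_literal"] parser_step_simps
        del: One_nat_def)
qed (simp add: encode_cnf_def encode_list_def parser_step_simps del: One_nat_def)

text \<open>Each state is given the set of incomplete encodings that can lead to it, as an invariant
  over prefixes. \<open>cs\<close> and \<open>ls\<close> are the list encodings without their
  terminating bit.\<close>

lemma parse_sound:
  fixes w :: "bool list"
  defines "cs \<equiv> \<lambda>\<phi>. concat (map (\<lambda>C. True # encode_list encode_literal C) \<phi>)"
    and "ls \<equiv> \<lambda>C. concat (map (\<lambda>l. True # encode_literal l) C)"
    and "i \<equiv> data_length (data_hd (parse w (parser_state 0 Leaf Leaf Leaf Leaf)))"
  shows "i \<in> {0..5} \<and> (i = 0 \<longrightarrow> (\<exists>\<phi>. w = cs \<phi>)) \<and> (i = 1 \<longrightarrow> (\<exists>\<phi> C. w = cs \<phi> @ True # ls C)) \<and>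
    (i = 2 \<longrightarrow> (\<exists>\<phi> C. w = cs \<phi> @ True # ls C @ [True])) \<and>
    (i = 3 \<longrightarrow> (\<exists>\<phi> C b n. w = cs \<phi> @ True # ls C @ True # b # replicate n True)) \<and>
    (i = 4 \<longrightarrow> (\<exists>\<phi>. w = encode_cnf \<phi>))"
  unfolding i_def
proof (induction w rule: rev_induct)
  case Nil
  have "[] = cs []" by (simp add: cs_def)
  then show ?case by (auto simp: parser_state_def)
next
  case (snoc b w)
  define a where "a = parse w (parser_state 0 Leaf Leaf Leaf Leaf)"
  define j where "j = data_length (data_hd a)"
  note IH = snoc[folded a_def, folded j_def]
  have next_state: "data_length (data_hd (parse (w @ [b]) (parser_state 0 Leaf Leaf Leaf Leaf))) =
      (if j = 0 then if b then 1 else 4 else if j = 1 then if b then 2 else 0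
       else if j = 2 then 3 else if j = 3 then if b then 3 else 1 else 5)"
  proof -
    have "parse (w @ [b]) (parser_state 0 Leaf Leaf Leaf Leaf) = parser_step (data_of_bool b) a"
      by (simp add: a_def)
    then show ?thesis
      by (simp add: j_def parser_step_def Let_def parser_state_def del: data_length_eq_0)
  qed
  consider "j = 0" | "j = 1" | "j = 2" | "j = 3" | "j > 3" by linarith
  then show ?case
  proof cases
    case 1
    then obtain \<phi> where w: "w = cs \<phi>" using IH by auto
    have "w @ [True] = cs \<phi> @ True # ls []" "w @ [False] = encode_cnf \<phi>"
      by (simp_all add: w ls_def cs_def encode_cnf_def encode_list_def)
    then show ?thesis unfolding next_state using 1 by (cases b) auto
  next
    case 2
    then obtain \<phi> C where w: "w = cs \<phi> @ True # ls C" using IH by auto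
    then have "w @ [True] = cs \<phi> @ True # ls C @ [True]" "w @ [False] = cs (\<phi> @ [C])"
      by (simp_all add: ls_def cs_def encode_list_def)
    then show ?thesis unfolding next_state using 2 by (cases b) auto
  next
    case 3
    then obtain \<phi> C where w: "w = cs \<phi> @ True # ls C @ [True]" using IH by auto
    then have "w @ [b] = cs \<phi> @ True # ls C @ True # b # replicate 0 True" by simp
    then have "\<exists>\<phi> C c n. w @ [b] = cs \<phi> @ True # ls C @ True # c # replicate n True" by blast
    then show ?thesis unfolding next_state using 3 by simp
  next
    case 4
    then obtain \<phi> C c n where w: "w = cs \<phi> @ True # ls C @ True # c # replicate n True"
      using IH by auto
    then have "w @ [True] = cs \<phi> @ True # ls C @ True # c # replicate (Suc n) True"
      by (simp add: replicate_append_same)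
    moreover have "w @ [False] = cs \<phi> @ True # ls (C @ [(c, n)])"
      by (simp add: w ls_def encode_literal_def encode_nat_def)
    ultimately have "\<exists>\<phi> C c n. w @ [True] = cs \<phi> @ True # ls C @ True # c # replicate n True"
      "\<exists>\<phi> C. w @ [False] = cs \<phi> @ True # ls C" by blast+
    then show ?thesis unfolding next_state using 4 by (cases b) simp_all
  next
    case 5
    then show ?thesis unfolding next_state by auto
  qed
qed

lemma data_parse_encode_cnf:
  "data_parse (data_of_list data_of_bool (encode_cnf \<phi>)) =
    parser_state 4 Leaf Leaf Leaf (data_of_cnf (reverse_cnf \<phi>))"
  using parse_cnf[of \<phi> "[]"] by (simp add: data_parse_def data_fold_of_list)

lemma data_parse_accepts:
  "data_length (data_hd (data_parse (data_of_list data_of_bool w))) = 4 \<longleftrightarrow> (\<exists>\<phi>. w = encode_cnf \<phi>)"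
proof
  assume "data_length (data_hd (data_parse (data_of_list data_of_bool w))) = 4"
  then show "\<exists>\<phi>. w = encode_cnf \<phi>"
    using parse_sound[of w] by (simp add: data_parse_def data_fold_of_list)
next
  assume "\<exists>\<phi>. w = encode_cnf \<phi>"
  then show "data_length (data_hd (data_parse (data_of_list data_of_bool w))) = 4"
    by (auto simp: data_parse_encode_cnf) (simp add: parser_state_def)
qed

subsection \<open>The instance of acyclic matching\<close>

lemma ptime2_Node: "ptime2 Node"
  unfolding ptime2_def by (intro ptime_intros)

primrec data_tuples :: "data \<Rightarrow> nat \<Rightarrow> data" where
  "data_tuples pins 0 = Node Leaf Leaf"
| "data_tuples pins (Suc n) = data_product Node Leaf pins (data_tuples pins n)"

lemma ptime_tuples: "ptime f \<Longrightarrow> ptime (\<lambda>x. data_tuples (f x) n)"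
proof (induction n)
  case (Suc n)
  then show ?case unfolding data_tuples.simps by (intro ptime_product ptime2_Node ptime_const)
qed (simp add: ptime_const)

lemma distinct_map_product:
  assumes "distinct xs" "distinct ys" "\<And>x y x' y'. r x y = r x' y' \<Longrightarrow> x = x' \<and> y = y'"
  shows "distinct (map (\<lambda>(x, y). r x y) (List.product xs ys))"
proof -
  have "inj_on (\<lambda>(x, y). r x y) A" for A by (rule inj_onI) (auto dest: assms(3))
  then show ?thesis using assms(1,2) by (simp add: distinct_map distinct_product)
qed

lemma data_tuples_of_list:
  assumes "distinct pins"
  shows "\<exists>es. data_tuples (data_of_list data_of_pin pins) n = data_of_list data_of_element es \<and>
    distinct es \<and> set es = {e. set e \<subseteq> set pins \<and> length e = n}"
proof (induction n)
  case 0
  show ?case by (rule exI[of _ "[[]]"]) auto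
next
  case (Suc n)
  then obtain es where es: "data_tuples (data_of_list data_of_pin pins) n = data_of_list data_of_element es"
    "distinct es" "set es = {e. set e \<subseteq> set pins \<and> length e = n}" by blast
  let ?es = "map (\<lambda>(x, y). x # y) (List.product (rev pins) (rev es))"
  have "data_tuples (data_of_list data_of_pin pins) (Suc n) = data_of_list data_of_element ?es"
    using data_product_of_list[of pins es Node data_of_pin data_of_element data_of_element Cons "[]"]
    by (simp add: es(1))
  moreover have "distinct ?es"
    by (rule distinct_map_product) (use assms es(2) in auto)
  moreover have "set ?es = {e. set e \<subseteq> set pins \<and> length e = Suc n}"
    by (auto simp: es(3) length_Suc_conv image_iff)
  ultimately show ?case by blast
qed

definition red_cnf :: "data \<Rightarrow> data" where
  "red_cnf z = data_tl (data_tl (data_tl (data_parse (data_hd z))))"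

definition red_pins :: "data \<Rightarrow> data" where
  "red_pins z = data_product Node Leaf (data_range (Node Leaf (Node Leaf (data_tl z))))
    (data_range (data_add (data_of_nat 2) (data_hd z)))"

definition red_elements :: "nat \<Rightarrow> data \<Rightarrow> data" where
  "red_elements D z = data_filter data_valid
    (Node (red_cnf z) (Node (data_tl z) (data_add (data_of_nat 0) (data_hd z))))
    (data_tuples (red_pins z) D)"

text \<open>With \<open>2 * (k + 2)\<close> half graphs this is the least \<open>t\<close> that
  satisfies \<open>R_less\<close>.\<close>

definition red_copies :: "data \<Rightarrow> data" where
  "red_copies k = data_add (data_of_nat 1) (data_mult (data_of_nat 4) (Node Leaf (Node Leaf k)))"

definition red_param :: "nat \<Rightarrow> data \<Rightarrow> data" where
  "red_param D k = data_mult (data_power (Node Leaf (Node Leaf k)) D) (red_copies k)"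

definition red_vertices :: "nat \<Rightarrow> data \<Rightarrow> data" where
  "red_vertices D z = data_product Node Leaf (data_of_list data_of_bool [True, False])
    (data_product Node Leaf (red_elements D z) (data_range (red_copies (data_tl z))))"

definition data_encode_graph :: "(data \<Rightarrow> data \<Rightarrow> data) \<Rightarrow> data \<Rightarrow> data" where
  "data_encode_graph adj l = data_fold (\<lambda>_ a. Node (data_of_bool True) a)
    (Node (data_of_bool False) (data_product adj Leaf l l)) l"

text \<open>The fallback \<open>Node Leaf Leaf\<close> is the empty string with parameter 0, a
  no-instance because the target problem asks for a positive parameter.\<close>

definition reduction :: "nat \<Rightarrow> data \<Rightarrow> data" where
  "reduction d z = data_if
    (data_and (data_eq (data_hd (data_parse (data_hd z))) (data_of_nat 4))
      (data_all (\<lambda>c C. data_le C c) (data_of_nat d) (red_cnf z)))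
    (Node (data_encode_graph (data_adjacent (2 * d)) (red_vertices (2 * d) z)) (red_param (2 * d) (data_tl z)))
    (Node Leaf Leaf)"

lemma ptime_param: "ptime f \<Longrightarrow> ptime (\<lambda>x. red_param D (f x))"
  unfolding red_param_def red_copies_def by (intro ptime_lists)

lemma ptime_encode_graph:
  assumes "ptime2 adj" "ptime f" shows "ptime (\<lambda>x. data_encode_graph adj (f x))"
  unfolding data_encode_graph_def
  by (rule ptime_fold[where h = "\<lambda>_ _ a. Node (data_of_bool True) a" and C = "\<lambda>_. Leaf"])
    (intro ptime_lists additive_Node additive_acc assms)+

lemma ptime_reduction: "ptime (reduction d)"
proof -
  have cnf: "ptime red_cnf"
    unfolding red_cnf_def[abs_def] by (intro ptime_lists ptime_parse)
  have "ptime (red_elements D)" for D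
    unfolding red_elements_def[abs_def] red_pins_def
    by (intro ptime_lists ptime_valid ptime_tuples ptime2_Node ptime_comp[OF cnf])
  then have el: "ptime (\<lambda>z. red_elements D z)" for D .
  have "ptime (red_vertices D)" for D
    unfolding red_vertices_def[abs_def] red_copies_def
    by (intro ptime_lists ptime2_Node el)
  then have vert: "ptime (\<lambda>z. red_vertices D z)" for D .
  have le: "ptime2 (\<lambda>c C. data_le C c)" unfolding ptime2_def by (intro ptime_lists)
  show ?thesis
    unfolding reduction_def[abs_def]
    by (intro ptime_if ptime_and ptime_eq ptime_hd ptime_parse ptime_id ptime_const ptime_all le
        ptime_comp[OF cnf] ptime_Node ptime_encode_graph ptime_adjacent vert ptime_param ptime_tl)
qed

text \<open>Stated for \<open>rev L\<close> because \<open>data_product\<close> enumerates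
  backwards; the matrix then follows the order of \<open>L\<close>. Vertices are numbered by their
  place in \<open>L\<close>, so no numbering has to be computed.\<close>

lemma data_encode_graph_of_list:
  assumes "\<And>u w. u \<in> set L \<Longrightarrow> w \<in> set L \<Longrightarrow> adj (f u) (f w) = data_of_bool (Q u w)"
  shows "data_encode_graph adj (data_of_list f (rev L)) = data_of_list data_of_bool
    (encode_nat (length L) @ concat (map (\<lambda>u. map (Q u) L) L))"
proof -
  have "data_product adj Leaf (data_of_list f (rev L)) (data_of_list f (rev L)) =
      data_of_list data_of_bool (concat (map (\<lambda>u. map (Q u) L) L))"
    using data_product_of_list[of "rev L" "rev L" adj f f data_of_bool Q "[]"] assms
    by (simp add: product_concat_map map_concat comp_def)
  moreover have "(Node (data_of_bool True) ^^ n) (data_of_list data_of_bool zs) =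
      data_of_list data_of_bool (replicate n True @ zs)" for n zs
    by (induction n) auto
  from this[of _ "False # _"] have "(Node (data_of_bool True) ^^ n) (Node (data_of_bool False)
      (data_of_list data_of_bool zs)) = data_of_list data_of_bool (encode_nat n @ zs)" for n zs
    by (simp add: encode_nat_def)
  ultimately show ?thesis by (simp add: data_encode_graph_def data_fold_const)
qed

lemma red_vertices:
  assumes "red_cnf (data_of_instance x k) = data_of_cnf \<phi>"
  shows "\<exists>L. red_vertices D (data_of_instance x k) = data_of_list data_of_vertex (rev L) \<and>
    distinct L \<and> set L = UNIV \<times> elements \<phi> k (length x) D \<times> {..<4 * (k + 2) + 1}"
proof -
  let ?z = "data_of_instance x k" and ?N = "length x" and ?t = "4 * (k + 2) + 1"
  let ?pins = "List.product (rev [0..<k + 2]) (rev [0..<?N + 2])"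
  have z: "data_hd ?z = data_of_list data_of_bool x" "data_tl ?z = data_of_nat k"
    by (simp_all add: data_of_instance_def)
  have k2: "Node Leaf (Node Leaf (data_of_nat k)) = data_of_nat (k + 2)" by simp
  have "red_pins ?z = data_of_list data_of_pin ?pins"
    using data_product_of_list[of "[0..<k + 2]" "[0..<?N + 2]" Node data_of_nat data_of_nat data_of_pin Pair "[]"]
    unfolding red_pins_def z k2 data_add data_range_of_nat
    by (simp add: add.commute del: upt_Suc)
  moreover have "distinct ?pins" by (rule distinct_product) simp_all
  then obtain es where es: "data_tuples (data_of_list data_of_pin ?pins) D = data_of_list data_of_element es"
      "distinct es" "set es = {e. set e \<subseteq> set ?pins \<and> length e = D}"
    using data_tuples_of_list by blast
  ultimately have "red_elements D ?z = data_of_list data_of_element (rev (filter (valid \<phi> k ?N) es))"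
    unfolding red_elements_def z assms by (simp add: data_filter_of_list del: data_of_nat_simps)
  moreover define vs where "vs = rev (filter (valid \<phi> k ?N) es)"
  ultimately have V1: "red_elements D ?z = data_of_list data_of_element vs" by simp
  have V2: "distinct vs" using es(2) by (simp add: vs_def)
  have "set ?pins = {..<k + 2} \<times> {..<?N + 2}" by (simp add: lessThan_atLeast0 del: upt_Suc)
  then have V3: "set vs = elements \<phi> k ?N D"
    unfolding vs_def set_rev set_filter es(3) elements_def by auto
  have t: "red_copies (data_of_nat k) = data_of_nat ?t"
    unfolding red_copies_def k2 by (simp del: data_of_nat_simps)
  let ?cs = "List.product (rev vs) (rev [0..<?t])"
  define f where "f = (\<lambda>(e, s). Node (data_of_element e) (data_of_nat s))"
  have cs: "data_product Node Leaf (red_elements D ?z) (data_range (red_copies (data_tl ?z))) =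
      data_of_list f ?cs"
    using data_product_of_list[of vs "[0..<?t]" Node data_of_element data_of_nat f Pair "[]"]
    unfolding V1 z t data_range_of_nat by (simp add: f_def del: upt_Suc)
  let ?L = "List.product (rev [True, False]) (rev ?cs)"
  have f: "Node (data_of_bool b) (f y) = data_of_vertex (b, y)" for b y
    by (cases y) (simp add: f_def)
  have "red_vertices D ?z = data_of_list data_of_vertex (rev (rev ?L))"
    using data_product_of_list[of "[True, False]" ?cs Node data_of_bool f data_of_vertex Pair "[]"]
    unfolding red_vertices_def cs by (simp add: f del: upt_Suc)
  moreover have "distinct (rev ?L)"
    unfolding distinct_rev by (intro distinct_product) (use V2 in \<open>simp_all add: distinct_product\<close>)
  moreover have "set (rev ?L) = UNIV \<times> elements \<phi> k ?N D \<times> {..<?t}"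
    by (auto simp: V3 simp del: upt_Suc)
  ultimately show ?thesis by blast
qed

lemma length_encode_list_elem: "y \<in> set ys \<Longrightarrow> length (f y) \<le> length (encode_list f ys)"
  by (induction ys) (auto simp: encode_list_def)

text \<open>Variables are written in unary. The input length can therefore serve as
  \<open>N\<close>, and the number of pins stays polynomial.\<close>

lemma cnf_vars_less_length: "x \<in> cnf_vars \<phi> \<Longrightarrow> x < length (encode_cnf \<phi>)"
proof -
  assume "x \<in> cnf_vars \<phi>"
  then obtain C l where "C \<in> set \<phi>" "l \<in> set C" "x = snd l" by (auto simp: cnf_vars_def)
  then have "x < length (encode_literal l)" by (simp add: encode_literal_def encode_nat_def)
  also have "\<dots> \<le> length (encode_list encode_literal C)" by (rule length_encode_list_elem) fact
  also have "\<dots> \<le> length (encode_cnf \<phi>)" unfolding encode_cnf_def by (rule length_encode_list_elem) fact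
  finally show ?thesis .
qed

lemma weighted_cnf_sat_encode_iff:
  "(encode_cnf \<phi>, k) \<in> weighted_cnf_sat d \<longleftrightarrow>
    is_d_cnf d \<phi> \<and> (\<exists>S\<subseteq>cnf_vars \<phi>. card S = k \<and> satisfies S \<phi>)"
  unfolding weighted_cnf_sat_def by (auto simp: inj_eq[OF inj_encode_cnf])

text \<open>The parser returns clauses and literals in reverse order; by these facts the reversal
  need not be undone.\<close>

lemma reverse_cnf:
  "cnf_vars (reverse_cnf \<phi>) = cnf_vars \<phi>" "satisfies S (reverse_cnf \<phi>) \<longleftrightarrow> satisfies S \<phi>"
  "is_d_cnf d (reverse_cnf \<phi>) \<longleftrightarrow> is_d_cnf d \<phi>"
  by (auto simp: cnf_vars_def satisfies_def is_d_cnf_def)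

lemma acyclic_matching_problem_encode_iff:
  assumes "fst G = {..<n}" "simple_graph G" "P G" "0 < k"
  shows "(encode_graph G, k) \<in> acyclic_matching_problem P \<longleftrightarrow> (\<exists>M. acyclic_matching G M \<and> card M = k)"
proof
  assume "(encode_graph G, k) \<in> acyclic_matching_problem P"
  then obtain H m where H: "encode_graph G = encode_graph H" "fst H = {..<m}" "simple_graph H"
      "\<exists>M. acyclic_matching H M \<and> card M = k"
    unfolding acyclic_matching_problem_def by blast
  have "G = H" by (rule encode_graph_inj[OF assms(1,2) H(2,3,1)])
  then show "\<exists>M. acyclic_matching G M \<and> card M = k" using H(4) by simp
next
  assume "\<exists>M. acyclic_matching G M \<and> card M = k"
  then show "(encode_graph G, k) \<in> acyclic_matching_problem P"
    unfolding acyclic_matching_problem_def using assms by blast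
qed

lemma red_param: "red_param D (data_of_nat k) = data_of_nat ((k + 2) ^ D * (4 * (k + 2) + 1))"
proof -
  have k2: "Node Leaf (Node Leaf (data_of_nat k)) = data_of_nat (k + 2)" by simp
  show ?thesis unfolding red_param_def red_copies_def k2 by (simp del: data_of_nat_simps)
qed

lemma map_nth_upt: "map (\<lambda>i. f (xs ! i)) [0..<length xs] = map f xs"
  by (rule nth_equalityI) simp_all

lemma reduction_correct:
  assumes d: "1 \<le> d"
  shows "\<exists>x' k'. reduction d (data_of_instance x k) = data_of_instance x' k' \<and>
    k' \<le> (k + 2) ^ (2 * d) * (4 * (k + 2) + 1) \<and>
    ((x, k) \<in> weighted_cnf_sat d \<longleftrightarrow> (x', k') \<in> acyclic_matching_problem bipartite)"
proof -
  let ?z = "data_of_instance x k" and ?N = "length x" and ?D = "2 * d" and ?t = "4 * (k + 2) + 1"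
  have z: "data_hd ?z = data_of_list data_of_bool x" "data_tl ?z = data_of_nat k"
    by (simp_all add: data_of_instance_def)
  have cnf: "red_cnf ?z = data_of_cnf (reverse_cnf \<phi>)" if "x = encode_cnf \<phi>" for \<phi>
    unfolding red_cnf_def z using that by (simp add: data_parse_encode_cnf parser_state_def)
  have small: "data_all (\<lambda>c C. data_le C c) (data_of_nat d) (data_of_cnf \<psi>) = data_of_bool (is_d_cnf d \<psi>)" for \<psi>
    unfolding is_d_cnf_def by (rule data_all_of_list) simp
  show ?thesis
  proof (cases "\<exists>\<phi>. x = encode_cnf \<phi> \<and> is_d_cnf d \<phi>")
    case False
    have no: "(x, k) \<notin> weighted_cnf_sat d" using False by (auto simp: weighted_cnf_sat_def)
    have "reduction d ?z = Node Leaf Leaf"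
    proof (cases "\<exists>\<phi>. x = encode_cnf \<phi>")
      case True
      then obtain \<phi> where \<phi>: "x = encode_cnf \<phi>" by blast
      then have "\<not> is_d_cnf d (reverse_cnf \<phi>)" using False reverse_cnf by blast
      then show ?thesis unfolding reduction_def cnf[OF \<phi>] small by simp
    next
      case False
      then show ?thesis unfolding reduction_def z using data_parse_accepts[of x]
        by (simp add: data_and_def data_if_def[of Leaf])
    qed
    also have "\<dots> = data_of_instance [] 0" by (simp add: data_of_instance_def)
    finally show ?thesis using no
      by (intro exI[of _ "[]"] exI[of _ 0]) (simp add: acyclic_matching_problem_def)
  next
    case True
    then obtain \<phi> where \<phi>: "x = encode_cnf \<phi>" "is_d_cnf d \<phi>" by blast
    define \<psi> where "\<psi> = reverse_cnf \<phi>"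
    have \<psi>: "red_cnf ?z = data_of_cnf \<psi>" "is_d_cnf d \<psi>" "\<And>v. v \<in> cnf_vars \<psi> \<Longrightarrow> v < ?N"
      using cnf[OF \<phi>(1)] \<phi>(2) reverse_cnf cnf_vars_less_length unfolding \<psi>_def \<phi>(1) by blast+
    let ?V = "elements \<psi> k ?N ?D"
    obtain L where L: "red_vertices ?D ?z = data_of_list data_of_vertex (rev L)"
        "distinct L" "set L = UNIV \<times> ?V \<times> {..<?t}"
      using red_vertices[OF \<psi>(1)] by blast
    let ?n = "length L"
    let ?el = "\<lambda>i. fst (snd (L ! i))" and ?cp = "\<lambda>i. snd (snd (L ! i))" and ?sd = "\<lambda>i. fst (L ! i)"
    define G where "G = ({..<?n}, {{u, w} | u w. u \<in> {..<?n} \<and> w \<in> {..<?n} \<and> ?sd u \<and> \<not> ?sd w \<and>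
      (?el u = ?el w \<and> ?cp u = ?cp w \<or> conflict (?el u) (?el w))})"
    interpret conflict_graph "{..<?n}" ?V ?t ?el ?cp ?sd conflict "{..<k + 2} \<times> (UNIV :: bool set)"
      "pin_source ?N" "pin_target ?N" G
    proof
      have "bij_betw ((!) L) {..<?n} (UNIV \<times> ?V \<times> {..<?t})"
        using bij_betw_nth[OF L(2) refl refl] L(3) by simp
      \<comment> \<open>The list stores side, element and copy number, whereas the locale expects
        element, copy number and side.\<close>
      moreover have "bij_betw (\<lambda>v. (fst (snd v), snd (snd v), fst v)) (UNIV \<times> ?V \<times> {..<?t})
          (?V \<times> {..<?t} \<times> (UNIV :: bool set))"
        by (rule bij_betw_byWitness[where f' = "\<lambda>v. (snd (snd v), fst v, fst (snd v))"]) auto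
      ultimately have "bij_betw ((\<lambda>v. (fst (snd v), snd (snd v), fst v)) \<circ> (!) L) {..<?n} (?V \<times> {..<?t} \<times> UNIV)"
        by (rule bij_betw_trans)
      then show "bij_betw (\<lambda>i. (?el i, ?cp i, ?sd i)) {..<?n} (?V \<times> {..<?t} \<times> UNIV)"
        by (simp only: comp_def)
      show "finite ?V" by (rule finite_elements)
      show "2 * card ({..<k + 2} \<times> (UNIV :: bool set)) < ?t" by (simp add: card_cartesian_product)
      show "\<not> conflict e e" if "e \<in> ?V" for e using that by (simp add: elements_def valid_def)
    qed (simp_all add: conflict_sym conflict_iff_half_graphs G_def)
    have V: "length (fst (snd u)) = ?D" if "u \<in> set L" for u
      using that L(3) by (auto simp: elements_def)
    have "{i, j} \<in> snd G \<longleftrightarrow> adjacent (L ! i) (L ! j)" if "i < ?n" "j < ?n" for i j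
      using that by (cases "L ! i"; cases "L ! j") (simp add: edge_iff)
    then have "concat (map (\<lambda>i. map (\<lambda>j. {i, j} \<in> snd G) [0..<?n]) [0..<?n]) =
        concat (map (\<lambda>i. map (\<lambda>j. adjacent (L ! i) (L ! j)) [0..<?n]) [0..<?n])"
      by (intro arg_cong[of _ _ concat] map_cong refl) auto
    also have "\<dots> = concat (map (\<lambda>i. map (adjacent (L ! i)) L) [0..<?n])"
      by (simp only: map_nth_upt[of "adjacent _" L])
    also have "\<dots> = concat (map (\<lambda>u. map (adjacent u) L) L)"
      by (simp only: map_nth_upt[of "\<lambda>u. map (adjacent u) L" L])
    finally have "data_encode_graph (data_adjacent ?D) (red_vertices ?D ?z) =
        data_of_list data_of_bool (encode_graph G)"
      unfolding L(1) by (subst data_encode_graph_of_list[where Q = adjacent])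
        (simp_all add: data_adjacent V encode_graph_def G_def)
    moreover have "data_length (data_hd (data_parse (data_of_list data_of_bool x))) = 4"
      using data_parse_accepts \<phi>(1) by blast
    ultimately have red: "reduction d ?z = data_of_instance (encode_graph G) ((k + 2) ^ ?D * ?t)"
      unfolding reduction_def \<psi>(1) small z red_param
      using \<psi>(2) by (simp add: data_of_instance_def del: data_of_nat_simps)
    have "(x, k) \<in> weighted_cnf_sat d \<longleftrightarrow> (\<exists>S\<subseteq>cnf_vars \<psi>. card S = k \<and> satisfies S \<psi>)"
      unfolding \<phi>(1) weighted_cnf_sat_encode_iff using \<phi>(2) by (simp add: \<psi>_def reverse_cnf)
    also have "\<dots> \<longleftrightarrow> (\<exists>E\<subseteq>?V. (\<forall>e\<in>E. \<forall>e'\<in>E. \<not> conflict e e') \<and> card E = (k + 2) ^ ?D)"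
    proof
      assume "\<exists>S\<subseteq>cnf_vars \<psi>. card S = k \<and> satisfies S \<psi>"
      then obtain S where S: "S \<subseteq> cnf_vars \<psi>" "card S = k" "satisfies S \<psi>" by blast
      show "\<exists>E\<subseteq>?V. (\<forall>e\<in>E. \<forall>e'\<in>E. \<not> conflict e e') \<and> card E = (k + 2) ^ ?D"
        by (rule satisfiable_imp_independent_elements[OF \<psi>(3) S])
    next
      assume "\<exists>E\<subseteq>?V. (\<forall>e\<in>E. \<forall>e'\<in>E. \<not> conflict e e') \<and> card E = (k + 2) ^ ?D"
      then obtain E where E: "E \<subseteq> ?V" "\<forall>e\<in>E. \<forall>e'\<in>E. \<not> conflict e e'" "card E = (k + 2) ^ ?D" by blast
      show "\<exists>S\<subseteq>cnf_vars \<psi>. card S = k \<and> satisfies S \<psi>"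
        by (rule independent_elements_imp_satisfiable[OF \<psi>(2) d \<psi>(3) E])
    qed
    also have "\<dots> \<longleftrightarrow> (\<exists>M. acyclic_matching G M \<and> card M = (k + 2) ^ ?D * ?t)"
      by (rule acyclic_matching_iff_independent[symmetric])
    also have "\<dots> \<longleftrightarrow> (encode_graph G, (k + 2) ^ ?D * ?t) \<in> acyclic_matching_problem bipartite"
      by (rule acyclic_matching_problem_encode_iff[symmetric])
        (use simple bipartite in \<open>simp_all add: G_def\<close>)
    finally show ?thesis using red by blast
  qed
qed

theorem theorem2: "W1_hard (acyclic_matching_problem bipartite)"
  unfolding W1_hard_def
proof
  fix A assume "A \<in> W1"
  then obtain d where d: "1 \<le> d" "fpt_reducible A (weighted_cnf_sat d)"
    unfolding W1_def by blast
  show "fpt_reducible A (acyclic_matching_problem bipartite)"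
  proof (rule fpt_reducible_ptime[OF d(2) ptime_reduction])
    show "ptime (red_param (2 * d))" using ptime_param[OF ptime_id] .
    show "mono (\<lambda>k. (k + 2) ^ (2 * d) * (4 * (k + 2) + 1 :: nat))"
      by (intro monoI mult_mono power_mono add_mono) auto
  qed (use red_param reduction_correct[OF d(1)] in auto)
qed

end
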